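(* Let $A,B$ be real symmetric $4\times 4$ matrices defining quadrics $\mathcal A: X^TAX=0$, $\mathcal B: X^TBX=0$ in $\mathbb{PR}^3$ with $f(\lambda)=\det(\lambda A-B)$ not identically zero. If $f(\lambda)=0$ has one quadruple root with Segre characteristic $[(31)]$, then the only possible index sequences (up to equivalence) are $\langle 2\,{\wr\wr\wr}_{-}|\,2\rangle$ and $\langle 1\,{\wr\wr\wr}_{+}|\,3\rangle$. Furthermore: (1) when the index sequence is $\langle 2\,{\wr\wr\wr}_{-}|\,2\rangle$, the QSIC consists of a real conic and two real lines, and these three components intersect at a common real point; (2) when the index sequence is $\langle 1\,{\wr\wr\wr}_{+}|\,3\rangle$, the QSIC consists of a real conic and a pair of complex conjugate lines, and these three components intersect at a common real point.
   Context: $X=(x,y,z,w)^T$ homogeneous coordinates; QSIC $=\mathcal A\cap\mathcal B$. One may take $A$ nonsingular. Canonical form: for $A$ nonsingular there is a real invertible $Q$ with $Q^TAQ=\mathrm{diag}(\varepsilon_1E_1,\dots)$, $Q^TBQ=\mathrm{diag}(\varepsilon_1E_1J_1,\dots)$, $J_i$ the real Jordan blocks of $A^{-1}B$, $E_i$ anti-identity matrices of matching sizes, and $\varepsilon_i\in\{\pm1\}$ uniquely determined for blocks of real eigenvalues (the sign of $J_i$). Segre characteristic $[(31)]$: a single eigenvalue with a $3\times3$ and a $1\times1$ Jordan block. $\mathrm{Id}(\lambda)$ = number of positive eigenvalues of $\lambda A-B$. Index sequence $\langle s_0\sigma_1s_1\rangle$: $s_0,s_1$ the values of $\mathrm{Id}$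 before and after the root; $\sigma_1$ = three copies of $\wr$ with subscript the sign of the $3\times3$ block, followed by $|$ for the $1\times1$ block. Equivalence: induced by change of basis of the pencil (including $(A,B)\mapsto(-A,-B)$: $s\mapsto4-s$, signs reversed). *)

theory Defs
  imports "Jordan_Normal_Form.Jordan_Normal_Form" "Jordan_Normal_Form.Gauss_Jordan_Elimination"
    "Jordan_Normal_Form.Char_Poly"
begin

definition segre_31 :: "real mat \<Rightarrow> real mat \<Rightarrow> real \<Rightarrow> bool" where
  "segre_31 A B l0 = jordan_nf (the (mat_inverse A) * B) [(3, l0), (1, l0)]"

definition num_pos_eig :: "real mat \<Rightarrow> nat" where
  "num_pos_eig M = (\<Sum>a\<in>{a. a > 0 \<and> poly (char_poly M) a = 0}. order a (char_poly M))"

definition Id_pencil :: "real mat \<Rightarrow> real mat \<Rightarrow> real \<Rightarrow> nat" where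
  "Id_pencil A B l = num_pos_eig (l \<cdot>\<^sub>m A - B)"

definition anti_id :: "nat \<Rightarrow> real mat" where
  "anti_id n = mat n n (\<lambda>(i,j). if i + j = n - 1 then 1 else 0)"

definition canonA_31 :: "int \<Rightarrow> int \<Rightarrow> real mat" where
  "canonA_31 e e2 = four_block_mat (of_int e \<cdot>\<^sub>m anti_id 3) (0\<^sub>m 3 1) (0\<^sub>m 1 3)
      (of_int e2 \<cdot>\<^sub>m anti_id 1)"

definition canonB_31 :: "int \<Rightarrow> int \<Rightarrow> real \<Rightarrow> real mat" where
  "canonB_31 e e2 l0 = four_block_mat (of_int e \<cdot>\<^sub>m (anti_id 3 * jordan_block 3 l0)) (0\<^sub>m 3 1)
      (0\<^sub>m 1 3) (of_int e2 \<cdot>\<^sub>m (anti_id 1 * jordan_block 1 l0))"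

definition sign_block3 :: "real mat \<Rightarrow> real mat \<Rightarrow> real \<Rightarrow> int" where
  "sign_block3 A B l0 = (THE e. e \<in> {-1, 1} \<and> (\<exists>Q e2. Q \<in> carrier_mat 4 4 \<and> det Q \<noteq> 0
       \<and> e2 \<in> {-1, 1} \<and> transpose_mat Q * A * Q = canonA_31 e e2
       \<and> transpose_mat Q * B * Q = canonB_31 e e2 l0))"

text \<open>Index sequence <s0 sigma1 s1>: (Id before the root, sign of the 3x3 block, Id after the root).
 The 1x1 block symbol carries no information and is omitted.\<close>
definition index_seq :: "real mat \<Rightarrow> real mat \<Rightarrow> real \<Rightarrow> nat \<times> int \<times> nat" where
  "index_seq A B l0 =
     (THE s. \<forall>\<^sub>F l in at_left l0. Id_pencil A B l = s,
      sign_block3 A B l0,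
      THE s. \<forall>\<^sub>F l in at_right l0. Id_pencil A B l = s)"

text \<open>Equivalence induced by (A,B) -> (-A,-B): s -> 4 - s, sign reversed.\<close>
definition idx_neg :: "nat \<times> int \<times> nat \<Rightarrow> nat \<times> int \<times> nat" where
  "idx_neg s = (case s of (s0, e, s1) \<Rightarrow> (4 - s0, - e, 4 - s1))"

definition idx_equiv :: "nat \<times> int \<times> nat \<Rightarrow> nat \<times> int \<times> nat \<Rightarrow> bool" where
  "idx_equiv s t \<longleftrightarrow> s = t \<or> s = idx_neg t"

section \<open>Geometry in complex projective 3-space, points represented by nonzero vectors of C^4\<close>

definition cvec :: "real vec \<Rightarrow> complex vec" where
  "cvec v = map_vec complex_of_real v"

definition cmat :: "real mat \<Rightarrow> complex mat" where
  "cmat M = map_mat complex_of_real M"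

definition conj_vec :: "complex vec \<Rightarrow> complex vec" where
  "conj_vec v = map_vec cnj v"

definition qsic :: "real mat \<Rightarrow> real mat \<Rightarrow> complex vec set" where
  "qsic A B = {X. X \<in> carrier_vec 4 \<and> X \<noteq> 0\<^sub>v 4 \<and> X \<bullet> (cmat A *\<^sub>v X) = 0 \<and> X \<bullet> (cmat B *\<^sub>v X) = 0}"

definition is_real_point :: "complex vec \<Rightarrow> bool" where
  "is_real_point X \<longleftrightarrow> (\<exists>x. x \<in> carrier_vec 4 \<and> X = cvec x)"

definition lin_indep2 :: "complex vec \<Rightarrow> complex vec \<Rightarrow> bool" where
  "lin_indep2 u v \<longleftrightarrow> (\<forall>a b. a \<cdot>\<^sub>v u + b \<cdot>\<^sub>v v = 0\<^sub>v 4 \<longrightarrow> a = 0 \<and> b = 0)"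

definition span_line :: "complex vec \<Rightarrow> complex vec \<Rightarrow> complex vec set" where
  "span_line u v = {a \<cdot>\<^sub>v u + b \<cdot>\<^sub>v v | a b. (a, b) \<noteq> (0, 0)}"

definition is_line :: "complex vec set \<Rightarrow> bool" where
  "is_line L \<longleftrightarrow> (\<exists>u v. u \<in> carrier_vec 4 \<and> v \<in> carrier_vec 4 \<and> lin_indep2 u v \<and> L = span_line u v)"

definition is_real_line :: "complex vec set \<Rightarrow> bool" where
  "is_real_line L \<longleftrightarrow> (\<exists>u v. u \<in> carrier_vec 4 \<and> v \<in> carrier_vec 4 \<and> lin_indep2 (cvec u) (cvec v)
      \<and> L = span_line (cvec u) (cvec v))"

definition lin_indep3 :: "complex vec \<Rightarrow> complex vec \<Rightarrow> complex vec \<Rightarrow> bool" where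
  "lin_indep3 p q r \<longleftrightarrow> (\<forall>a b c. a \<cdot>\<^sub>v p + b \<cdot>\<^sub>v q + c \<cdot>\<^sub>v r = 0\<^sub>v 4 \<longrightarrow> a = 0 \<and> b = 0 \<and> c = 0)"

definition conic_set :: "complex vec \<Rightarrow> complex vec \<Rightarrow> complex vec \<Rightarrow> complex mat \<Rightarrow> complex vec set" where
  "conic_set p q r M = {a \<cdot>\<^sub>v p + b \<cdot>\<^sub>v q + c \<cdot>\<^sub>v r | a b c. (a, b, c) \<noteq> (0, 0, 0)
       \<and> vec_of_list [a, b, c] \<bullet> (M *\<^sub>v vec_of_list [a, b, c]) = 0}"

definition is_real_conic :: "complex vec set \<Rightarrow> bool" where
  "is_real_conic C \<longleftrightarrow> (\<exists>p q r M. p \<in> carrier_vec 4 \<and> q \<in> carrier_vec 4 \<and> r \<in> carrier_vec 4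
      \<and> lin_indep3 (cvec p) (cvec q) (cvec r)
      \<and> M \<in> carrier_mat 3 3 \<and> transpose_mat M = M \<and> det M \<noteq> 0
      \<and> C = conic_set (cvec p) (cvec q) (cvec r) (cmat M))"

definition qsic_conic_two_real_lines :: "real mat \<Rightarrow> real mat \<Rightarrow> bool" where
  "qsic_conic_two_real_lines A B \<longleftrightarrow> (\<exists>C L1 L2. is_real_conic C \<and> is_real_line L1 \<and> is_real_line L2
      \<and> L1 \<noteq> L2 \<and> qsic A B = C \<union> L1 \<union> L2
      \<and> (\<exists>X. is_real_point X \<and> X \<in> C \<and> X \<in> L1 \<and> X \<in> L2))"

definition qsic_conic_conj_lines :: "real mat \<Rightarrow> real mat \<Rightarrow> bool" where
  "qsic_conic_conj_lines A B \<longleftrightarrow> (\<exists>C L1 L2. is_real_conic C \<and> is_line L1 \<and> L2 = conj_vec ` L1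
      \<and> L1 \<noteq> L2 \<and> qsic A B = C \<union> L1 \<union> L2
      \<and> (\<exists>X. is_real_point X \<and> X \<in> C \<and> X \<in> L1 \<and> X \<in> L2))"

end

theory Submission
  imports Defs "Jordan_Normal_Form.Schur_Decomposition"
begin

text \<open>
  Write \<open>J = l\<^sub>0 + N\<close> for the Jordan form of \<open>A\<^sup>-\<^sup>1B\<close>. In a Jordan basis, symmetry of \<open>A\<close> and
  of \<open>A J\<close> says that \<open>N\<close> is
  self-adjoint for the form \<open>A\<close>, which makes the 3x3 block of \<open>A\<close> a Hankel matrix; a change of basis
  commuting with \<open>J\<close> reduces it to the canonical form with signs \<open>e, e2\<close>. With \<open>m = l - l\<^sub>0\<close>, the canonical
  \<open>l A - B\<close> is congruent to \<open>diag(e m\<^sup>3, e m, -e/m, e2 m)\<close>, so Sylvester's law of inertia gives the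
  index sequence. Finally the canonical pencil contains the quadric \<open>y z = 0\<close>: the plane \<open>y = 0\<close>
  cuts out a conic, and \<open>z = 0\<close> cuts out the two lines \<open>e y\<^sup>2 + e2 w\<^sup>2 = 0\<close>, which are real
  exactly when \<open>e2 = -e\<close>; all three pass through \<open>(1,0,0,0)\<close>.
\<close>

section \<open>Spectral theorem and law of inertia for real symmetric matrices\<close>

lemma adjoint_scalar_prod:
  fixes A :: "'a :: comm_semiring_0 mat"
  assumes "A \<in> carrier_mat nr nc" "x \<in> carrier_vec nc" "y \<in> carrier_vec nr"
  shows "y \<bullet> (A *\<^sub>v x) = (transpose_mat A *\<^sub>v y) \<bullet> x"
  by (rule transpose_vec_mult_scalar[OF assms, symmetric])

section \<open>Orthogonal diagonalization of real symmetric matrices\<close>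

text \<open>Over the complex numbers some eigenvalue \<open>a\<close> with eigenvector
  \<open>v\<close> exists. As \<open>M\<close> is real and symmetric, evaluating
  \<open>conjugate v \<bullet> (M v)\<close> in two ways gives \<open>cnj a\<close> and
  \<open>a\<close> times the nonzero number \<open>conjugate v \<bullet> v\<close>. So
  \<open>a\<close> is real and is a root of the real characteristic polynomial, which yields a real
  eigenvector.\<close>

lemma real_symmetric_eigenvector:
  fixes M :: "real mat"
  assumes M: "M \<in> carrier_mat n n" and sym: "transpose_mat M = M" and n: "n \<noteq> 0"
  shows "\<exists>v e. eigenvector M v e"
proof -
  let ?M = "map_mat complex_of_real M"
  have cM: "?M \<in> carrier_mat n n" using M by simp
  obtain as where cp: "char_poly ?M = (\<Prod>a\<leftarrow>as. [:- a, 1:])" and len: "length as = n"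
    using char_poly_factorized[OF cM] by blast
  then obtain a as' where as: "as = a # as'" using n by (cases as) auto
  have root: "poly (char_poly ?M) a = 0" by (simp add: cp as)
  then have "eigenvalue ?M a" using eigenvalue_root_char_poly[OF cM] by simp
  then obtain v where v: "v \<in> carrier_vec n" "v \<noteq> 0\<^sub>v n" and ev: "?M *\<^sub>v v = a \<cdot>\<^sub>v v"
    using cM by (auto simp: eigenvalue_def eigenvector_def)
  have cv: "conjugate v \<in> carrier_vec n" using v by simp
  have conjM: "?M *\<^sub>v conjugate v = conjugate (?M *\<^sub>v v)"
    using M v by (intro eq_vecI) (auto simp: scalar_prod_def)
  have "cnj a * (conjugate v \<bullet> v) = conjugate (a \<cdot>\<^sub>v v) \<bullet> v"
    using v cv by (simp add: conjugate_smult_vec)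
  also have "\<dots> = (?M *\<^sub>v conjugate v) \<bullet> v" using conjM ev by simp
  also have "\<dots> = conjugate v \<bullet> (?M *\<^sub>v v)"
    using adjoint_scalar_prod[OF cM v(1) cv] sym
    by (metis map_mat_transpose)
  also have "\<dots> = a * (conjugate v \<bullet> v)" unfolding ev using v cv by simp
  finally have "cnj a = a"
    using v by (simp add: conjugate_vec_sprod_comm[OF v(1) v(1), symmetric] del: conjugate_complex_def)
  then have "a = complex_of_real (Re a)" by (simp add: complex_eq_iff)
  moreover have "char_poly ?M = map_poly complex_of_real (char_poly M)"
    using of_real_hom.char_poly_hom[OF M] .
  ultimately have "complex_of_real (poly (char_poly M) (Re a)) = 0"
    using root by (metis of_real_hom.poly_map_poly)
  then have "poly (char_poly M) (Re a) = 0" by simp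
  then have "eigenvalue M (Re a)" using eigenvalue_root_char_poly[OF M] by simp
  then show ?thesis by (auto simp: eigenvalue_def)
qed

text \<open>Gram-Schmidt keeps the first vector of the basis it is given. Applied to a basis
  starting with \<open>v\<close>, it therefore produces an orthogonal basis that still starts with
  \<open>v\<close>, and normalization only rescales.\<close>

lemma orthonormal_completion:
  fixes v :: "real vec"
  assumes v: "v \<in> carrier_vec n" "v \<noteq> 0\<^sub>v n"
  shows "\<exists>W c. W \<in> carrier_mat n n \<and> transpose_mat W * W = 1\<^sub>m n \<and> col W 0 = c \<cdot>\<^sub>v v"
proof -
  interpret cof_vec_space n "TYPE(real)" .
  define b where "b = basis_completion v"
  note bc = basis_completion[OF v, folded b_def]
  have n: "n \<noteq> 0" using v by auto
  define ws where "ws = gram_schmidt n b"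
  have gs: "set ws \<subseteq> carrier_vec n" "corthogonal ws" and len: "length ws = n"
    using gram_schmidt_result[OF bc(2,4,5) ws_def] bc(6) by auto
  obtain vs where bv: "b = v # vs" using bc(6,7) n by (cases b) auto
  have "hd ws = v" using gram_schmidt_hd[OF v(1), of vs] by (simp add: ws_def bv)
  then have ws0: "ws ! 0 = v" using len n by (cases ws) auto
  have wsc: "ws ! i \<in> carrier_vec n" if "i < n" for i using gs(1) len that by auto
  have orth: "ws ! i \<bullet> ws ! j = 0 \<longleftrightarrow> i \<noteq> j" if "i < n" "j < n" for i j
    using corthogonalD[OF gs(2), of i j] that len by simp
  have pos: "ws ! i \<bullet> ws ! i > 0" if "i < n" for i
    using orth[OF that that] conjugate_square_ge_0_vec[of "ws ! i"] by simp
  \<comment> \<open>The vectors \<open>ws\<close> are orthogonal but not yet of length one.\<close>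
  define us where "us = map (\<lambda>w. (1 / sqrt (w \<bullet> w)) \<cdot>\<^sub>v w) ws"
  define W where "W = mat_of_cols n us"
  have W: "W \<in> carrier_mat n n" by (simp add: W_def us_def len mat_of_cols_def)
  have colW: "col W i = (1 / sqrt (ws ! i \<bullet> ws ! i)) \<cdot>\<^sub>v ws ! i" if "i < n" for i
    unfolding W_def using that len wsc[OF that] by (subst col_mat_of_cols) (auto simp: us_def)
  have "transpose_mat W * W = 1\<^sub>m n"
  proof (rule eq_matI)
    fix i j assume ij: "i < dim_row (1\<^sub>m n :: real mat)" "j < dim_col (1\<^sub>m n :: real mat)"
    have "(transpose_mat W * W) $$ (i, j) = col W i \<bullet> col W j" using ij W by simp
    also have "\<dots> = (1 / sqrt (ws ! i \<bullet> ws ! i)) * (1 / sqrt (ws ! j \<bullet> ws ! j)) * (ws ! i \<bullet> ws ! j)"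
      using ij wsc[of i] wsc[of j] by (simp add: colW)
    also have "\<dots> = 1\<^sub>m n $$ (i, j)"
      using ij orth[of i j] pos[of i] by (auto simp: divide_simps)
    finally show "(transpose_mat W * W) $$ (i, j) = 1\<^sub>m n $$ (i, j)" .
  qed (use W in auto)
  then show ?thesis using W colW[of 0] n ws0 by blast
qed

lemma four_block_diag_mult:
  assumes "A1 \<in> carrier_mat m m" "A2 \<in> carrier_mat m m" "D1 \<in> carrier_mat n n" "D2 \<in> carrier_mat n n"
  shows "four_block_mat A1 (0\<^sub>m m n) (0\<^sub>m n m) D1 * four_block_mat A2 (0\<^sub>m m n) (0\<^sub>m n m) D2
    = four_block_mat (A1 * A2) (0\<^sub>m m n) (0\<^sub>m n m) (D1 * (D2 :: 'a :: comm_ring_1 mat))"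
  using assms by (subst mult_four_block_mat[of _ m m _ n _ n _ _ m _ n]) auto

text \<open>Induction on the size: an orthonormal basis beginning with an eigenvector splits off a
  1x1 block, and the induction hypothesis diagonalizes the remaining symmetric block
  \<open>N3\<close>.\<close>

theorem real_symmetric_diagonalization:
  fixes M :: "real mat"
  assumes "M \<in> carrier_mat n n" and "transpose_mat M = M"
  shows "\<exists>U d. U \<in> carrier_mat n n \<and> transpose_mat U * U = 1\<^sub>m n
    \<and> transpose_mat U * M * U = mat_diag n d"
  using assms
proof (induction n arbitrary: M)
  case 0
  then show ?case by (intro exI[of _ "1\<^sub>m 0"] exI[of _ "\<lambda>_. 0"]) (auto simp: mat_diag_def)
next
  case (Suc n)
  note M = Suc.prems(1) and sym = Suc.prems(2)
  obtain v e where ev: "eigenvector M v e"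
    using real_symmetric_eigenvector[OF M sym] by blast
  have v: "v \<in> carrier_vec (Suc n)" "v \<noteq> 0\<^sub>v (Suc n)" "M *\<^sub>v v = e \<cdot>\<^sub>v v"
    using ev M by (auto simp: eigenvector_def)
  obtain W c where W: "W \<in> carrier_mat (Suc n) (Suc n)" and WW: "transpose_mat W * W = 1\<^sub>m (Suc n)"
    and W0: "col W 0 = c \<cdot>\<^sub>v v" using orthonormal_completion[OF v(1,2)] by blast
  have Wt: "transpose_mat W \<in> carrier_mat (Suc n) (Suc n)" using W by simp
  define N where "N = transpose_mat W * M * W"
  have N: "N \<in> carrier_mat (Suc n) (Suc n)" using W M by (simp add: N_def)
  have Nsym: "transpose_mat N = N"
    unfolding N_def using W M sym
    by (simp add: transpose_mult[of _ "Suc n" "Suc n" _ "Suc n"] assoc_mult_mat[of _ "Suc n" "Suc n" _ "Suc n" _ "Suc n"])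
  have MW0: "M *\<^sub>v col W 0 = e \<cdot>\<^sub>v col W 0"
    unfolding W0 using v M by (simp add: mult_mat_vec smult_smult_assoc mult.commute)
  \<comment> \<open>Entry \<open>(i, 0)\<close> pairs column \<open>i\<close> of \<open>W\<close>
    with \<open>M\<close> applied to column 0, which is \<open>e\<close> times column 0.
    Orthonormality kills it unless \<open>i = 0\<close>, and symmetry then clears row 0.\<close>
  have N0: "N $$ (i, 0) = (if i = 0 then e else 0)" if "i < Suc n" for i
  proof -
    have "N $$ (i, 0) = col W i \<bullet> (M *\<^sub>v col W 0)"
      unfolding N_def using that W M
      by (subst assoc_mult_mat[of _ "Suc n" "Suc n" _ "Suc n" _ "Suc n"]) (auto simp: mult_mat_vec_def)
    also have "\<dots> = e * (col W i \<bullet> col W 0)" unfolding MW0 using W that by simp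
    also have "col W i \<bullet> col W 0 = (transpose_mat W * W) $$ (i, 0)" using W that by simp
    finally show ?thesis using that by (simp add: WW)
  qed
  define N3 where "N3 = mat n n (\<lambda>(i, j). N $$ (Suc i, Suc j))"
  have N3: "N3 \<in> carrier_mat n n" by (simp add: N3_def)
  have Nsym': "N $$ (i, j) = N $$ (j, i)" if "i < Suc n" "j < Suc n" for i j
    using that N arg_cong[OF Nsym, of "\<lambda>X. X $$ (i, j)"] by simp
  have "transpose_mat N3 = N3" by (intro eq_matI) (auto simp: N3_def Nsym')
  then obtain P d where P: "P \<in> carrier_mat n n" and PP: "transpose_mat P * P = 1\<^sub>m n"
    and Pd: "transpose_mat P * N3 * P = mat_diag n d" using Suc.IH[OF N3] by blast
  define d' where "d' = case_nat e d"
  let ?z = "0\<^sub>m 1 n :: real mat" and ?zt = "0\<^sub>m n 1 :: real mat"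
  define P' where "P' = four_block_mat (1\<^sub>m 1) ?z ?zt P"
  have "P' \<in> carrier_mat (1 + n) (1 + n)"
    unfolding P'_def using P by (intro four_block_carrier_mat) auto
  then have P': "P' \<in> carrier_mat (Suc n) (Suc n)" by simp
  have P't: "transpose_mat P' = four_block_mat (1\<^sub>m 1) ?z ?zt (transpose_mat P)"
    unfolding P'_def using transpose_four_block_mat[of "1\<^sub>m 1" 1 1 ?z n ?zt n P] P by simp
  have N0': "N $$ (0, j) = (if j = 0 then e else 0)" if "j < Suc n" for j
    using N0[OF that] Nsym'[of 0 j] that by simp
  have NB: "N = four_block_mat (e \<cdot>\<^sub>m 1\<^sub>m 1) ?z ?zt N3"
  proof (rule eq_matI)
    fix i j assume "i < dim_row (four_block_mat (e \<cdot>\<^sub>m 1\<^sub>m 1) ?z ?zt N3)"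
      "j < dim_col (four_block_mat (e \<cdot>\<^sub>m 1\<^sub>m 1) ?z ?zt N3)"
    then have "i < Suc n" "j < Suc n" by (auto simp: N3_def)
    then show "N $$ (i, j) = four_block_mat (e \<cdot>\<^sub>m 1\<^sub>m 1) ?z ?zt N3 $$ (i, j)"
      by (cases i; cases j) (simp_all add: N0 N0' N3_def)
  qed (use N N3 in auto)
  have "transpose_mat P' * N * P' = four_block_mat (e \<cdot>\<^sub>m 1\<^sub>m 1) ?z ?zt (mat_diag n d)"
    unfolding P't unfolding NB P'_def using P N3
    by (simp add: four_block_diag_mult[of _ "Suc 0" _ _ n] Pd)
  also have "\<dots> = mat_diag (Suc n) d'"
  proof (rule eq_matI)
    fix i j assume "i < dim_row (mat_diag (Suc n) d')" "j < dim_col (mat_diag (Suc n) d')"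
    then show "four_block_mat (e \<cdot>\<^sub>m 1\<^sub>m 1) ?z ?zt (mat_diag n d) $$ (i, j) = mat_diag (Suc n) d' $$ (i, j)"
      by (cases i; cases j) (simp_all add: mat_diag_def d'_def)
  qed (simp_all add: mat_diag_def)
  finally have d1: "transpose_mat P' * N * P' = mat_diag (Suc n) d'" .
  have o1: "transpose_mat P' * P' = 1\<^sub>m (Suc n)"
    unfolding P't unfolding P'_def using P
    by (simp add: four_block_diag_mult[of _ "Suc 0" _ _ n] PP)
  have P't_c: "transpose_mat P' \<in> carrier_mat (Suc n) (Suc n)" using P' by simp
  note as = assoc_mult_mat[of _ "Suc n" "Suc n" _ "Suc n" _ "Suc n"]
  have "transpose_mat (W * P') * (W * P') = transpose_mat P' * ((transpose_mat W * W) * P')"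
    using W P' Wt P't_c by (simp add: transpose_mult[OF W P'] as)
  also have "\<dots> = 1\<^sub>m (Suc n)" using P' o1 by (simp add: WW)
  finally have "transpose_mat (W * P') * (W * P') = 1\<^sub>m (Suc n)" .
  moreover have "transpose_mat (W * P') * M * (W * P') = transpose_mat P' * N * P'"
    using W P' Wt P't_c M by (simp add: transpose_mult[OF W P'] as N_def)
  ultimately show ?case using W P' d1 by (intro exI[of _ "W * P'"] exI[of _ d']) auto
qed

section \<open>Counting positive eigenvalues and Sylvester's law of inertia\<close>

lemma order_prod_linear_factors:
  fixes d :: "nat \<Rightarrow> real"
  shows "Polynomial.order a (\<Prod>i<n. [:- d i, 1:]) = card {i. i < n \<and> d i = a}"
proof (induction n)
  case (Suc n)
  have nz: "(\<Prod>i<n. [:- d i, 1:]) * [:- d n, 1:] \<noteq> 0"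
    by (simp only: mult_eq_0_iff prod_zero_iff finite_lessThan) auto
  have "{i. i < Suc n \<and> d i = a} = {i. i < n \<and> d i = a} \<union> (if d n = a then {n} else {})"
    by (auto simp: less_Suc_eq)
  then have "card {i. i < Suc n \<and> d i = a} = card {i. i < n \<and> d i = a} + (if d n = a then 1 else 0)"
    by (auto simp: card_insert_if)
  then show ?case by (simp add: order_mult[OF nz] Suc.IH order_linear' del: mult_pCons_right)
qed simp

text \<open>For orthogonal \<open>U\<close> a congruence is also a similarity, so \<open>M\<close>
  and the diagonal matrix share their characteristic polynomial. Grouping the indices by the value
  of \<open>d\<close> turns the sum of root multiplicities into a count of diagonal entries.\<close>

lemma num_pos_eig_orthogonal_diag:
  assumes M: "M \<in> carrier_mat n n" and U: "U \<in> carrier_mat n n"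
    and UU: "transpose_mat U * U = 1\<^sub>m n" and UMU: "transpose_mat U * M * U = mat_diag n d"
  shows "num_pos_eig M = card {i. i < n \<and> d i > 0}"
proof -
  have UU': "U * transpose_mat U = 1\<^sub>m n"
    using mat_mult_left_right_inverse[OF _ U UU] U by simp
  have "similar_mat_wit (mat_diag n d) M (transpose_mat U) U"
    using M U UU UU' UMU by (intro similar_mat_witI[of _ _ n]) auto
  then have "char_poly M = char_poly (mat_diag n d)"
    using char_poly_similar similar_mat_sym unfolding similar_mat_def by metis
  also have "\<dots> = (\<Prod>a\<leftarrow>diag_mat (mat_diag n d). [:- a, 1:])"
    by (rule char_poly_upper_triangular[of _ n]) (auto simp: mat_diag_def)
  also have "\<dots> = (\<Prod>i<n. [:- d i, 1:])"
    by (simp add: diag_mat_def mat_diag_def prod.list_conv_set_nth atLeast0LessThan)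
  finally have cp: "char_poly M = (\<Prod>i<n. [:- d i, 1:])" .
  have roots: "{a. a > 0 \<and> poly (char_poly M) a = 0} = d ` {i. i < n \<and> d i > 0}"
    by (auto simp: cp poly_prod)
  have "num_pos_eig M = (\<Sum>a\<in>d ` {i. i < n \<and> d i > 0}. card {i \<in> {i. i < n \<and> d i > 0}. d i = a})"
    unfolding num_pos_eig_def roots unfolding cp order_prod_linear_factors
    by (intro sum.cong refl arg_cong[of _ _ card]) auto
  also have "\<dots> = card {i. i < n \<and> d i > 0}"
    using sum.group[of "{i. i < n \<and> d i > 0}" "d ` {i. i < n \<and> d i > 0}" d "\<lambda>_. 1::nat"] by simp
  finally show ?thesis .
qed

text \<open>Fewer than \<open>n\<close> linear conditions have a common nonzero solution: padding
  the conditions with zero rows gives a square singular matrix \<open>K\<close>, and any nonzero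
  kernel vector of \<open>K\<close> will do.\<close>

lemma exists_orthogonal_vector:
  fixes vs :: "'a :: field vec list"
  assumes "set vs \<subseteq> carrier_vec n" and "length vs < n"
  shows "\<exists>x. x \<in> carrier_vec n \<and> x \<noteq> 0\<^sub>v n \<and> (\<forall>v\<in>set vs. v \<bullet> x = 0)"
proof -
  define K where "K = mat_of_rows n (vs @ replicate (n - length vs) (0\<^sub>v n))"
  have K: "K \<in> carrier_mat n n" using assms by (simp add: K_def mat_of_rows_def)
  have rowK: "row K i = (vs @ replicate (n - length vs) (0\<^sub>v n)) ! i" if "i < n" for i
    unfolding K_def using assms that
    by (intro mat_of_rows_row) (auto simp: nth_append)
  \<comment> \<open>The last row of \<open>K\<close> is padding, so the transpose annihilates the
    last unit vector.\<close>
  have "transpose_mat K *\<^sub>v unit_vec n (n - 1) = 0\<^sub>v n"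
  proof (rule eq_vecI)
    fix i assume "i < dim_vec (0\<^sub>v n :: 'a vec)"
    then have i: "i < n" by simp
    have "(transpose_mat K *\<^sub>v unit_vec n (n - 1)) $ i = row K (n - 1) $ i"
      using K i by simp
    also have "\<dots> = 0" using rowK[of "n - 1"] i assms by (simp add: nth_append)
    finally show "(transpose_mat K *\<^sub>v unit_vec n (n - 1)) $ i = 0\<^sub>v n $ i" using i by simp
  qed (use K in auto)
  moreover have "unit_vec n (n - 1) \<noteq> (0\<^sub>v n :: 'a vec)" using assms by simp
  ultimately have "det (transpose_mat K) = 0"
    using det_0_iff_vec_prod_zero_field[of "transpose_mat K" n] K by force
  then have "det K = 0" using det_transpose[OF K] by simp
  then obtain x where x: "x \<in> carrier_vec n" "x \<noteq> 0\<^sub>v n" "K *\<^sub>v x = 0\<^sub>v n"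
    using det_0_iff_vec_prod_zero_field[OF K] by blast
  have "v \<bullet> x = 0" if v: "v \<in> set vs" for v
  proof -
    obtain i where i: "i < length vs" "vs ! i = v" using v unfolding in_set_conv_nth by blast
    then have "row K i \<bullet> x = 0" using arg_cong[OF x(3), of "\<lambda>w. w $ i"] K assms by simp
    then show ?thesis using rowK[of i] i assms by (simp add: nth_append)
  qed
  then show ?thesis using x by blast
qed

lemma quadratic_form_mat_diag:
  assumes "x \<in> carrier_vec n"
  shows "x \<bullet> (mat_diag n d *\<^sub>v x) = (\<Sum>i<n. (d i :: real) * (x $ i)\<^sup>2)"
proof -
  have "(mat_diag n d *\<^sub>v x) $ i = d i * x $ i" if "i < n" for i
  proof -
    have "(mat_diag n d *\<^sub>v x) $ i = (\<Sum>j\<in>{0..<n}. (if j = i then d j * x $ j else 0))"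
      using that assms by (auto simp: mat_diag_def scalar_prod_def if_distrib[of "\<lambda>t. t * _"] eq_commute[of i] cong: if_cong)
    then show ?thesis using that by simp
  qed
  moreover have "dim_vec (mat_diag n d *\<^sub>v x) = n" by (simp add: mat_diag_def)
  ultimately show ?thesis
    by (simp add: scalar_prod_def[of x] power2_eq_square atLeast0LessThan mult.left_commute mult.commute del: dim_mult_mat_vec index_mult_mat_vec)
qed

text \<open>If the inequality failed, demanding \<open>x $ i = 0\<close> wherever \<open>d i\<close>
  is not positive and \<open>(R x) $ i = 0\<close> wherever \<open>g i\<close> is positive would
  impose fewer than \<open>n\<close> conditions. A nonzero solution makes the same quadratic form
  positive in the coordinates of \<open>d\<close> and at most zero in those of
  \<open>g\<close>.\<close>

lemma sylvester_le:
  fixes R :: "real mat"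
  assumes R: "R \<in> carrier_mat n n" and eq: "transpose_mat R * mat_diag n g * R = mat_diag n d"
  shows "card {i. i < n \<and> d i > 0} \<le> card {i. i < n \<and> g i > 0}"
proof (rule ccontr)
  assume less: "\<not> ?thesis"
  let ?I = "filter (\<lambda>i. \<not> d i > 0) [0..<n]" and ?J = "filter (\<lambda>i. g i > 0) [0..<n]"
  have "length ?I = card (set ?I)" and "length ?J = card (set ?J)"
    by (rule distinct_card[symmetric], simp)+
  moreover have "set ?I = {..<n} - {i. i < n \<and> d i > 0}" "set ?J = {i. i < n \<and> g i > 0}" by auto
  moreover have "card ({..<n} - {i. i < n \<and> d i > 0}) = n - card {i. i < n \<and> d i > 0}"
    by (subst card_Diff_subset) auto
  moreover have "card {i. i < n \<and> d i > 0} \<le> n" using card_mono[of "{..<n}" "{i. i < n \<and> d i > 0}"] by auto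
  ultimately have "length (map (unit_vec n) ?I @ map (row R) ?J) < n" using less by simp
  then obtain x where x: "x \<in> carrier_vec n" "x \<noteq> 0\<^sub>v n"
    and orth: "\<forall>v\<in>set (map (unit_vec n) ?I @ map (row R) ?J). v \<bullet> x = 0"
    using exists_orthogonal_vector[of "map (unit_vec n) ?I @ map (row R) ?J" n] R by fastforce
  have x0: "x $ i = 0" if "i < n" "\<not> d i > 0" for i
  proof -
    have "unit_vec n i \<bullet> x = 0" using orth that by simp
    then show ?thesis using that x by simp
  qed
  have y0: "(R *\<^sub>v x) $ i = 0" if "i < n" "g i > 0" for i
    using orth that R by simp
  have y: "R *\<^sub>v x \<in> carrier_vec n" using R x by simp
  have D: "mat_diag n g \<in> carrier_mat n n" by simp
  have "(\<Sum>i<n. d i * (x $ i)\<^sup>2) = x \<bullet> (transpose_mat R * mat_diag n g * R *\<^sub>v x)"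
    using x by (simp add: eq quadratic_form_mat_diag)
  also have "transpose_mat R * mat_diag n g * R *\<^sub>v x = transpose_mat R *\<^sub>v (mat_diag n g *\<^sub>v (R *\<^sub>v x))"
    using R D x by (simp add: assoc_mult_mat_vec[of _ n n _ n])
  also have "x \<bullet> \<dots> = (R *\<^sub>v x) \<bullet> (mat_diag n g *\<^sub>v (R *\<^sub>v x))"
    using adjoint_scalar_prod[of "transpose_mat R" n n "mat_diag n g *\<^sub>v (R *\<^sub>v x)" x] R D x y
    by (simp)
  also have "\<dots> = (\<Sum>i<n. g i * ((R *\<^sub>v x) $ i)\<^sup>2)" using y by (rule quadratic_form_mat_diag)
  also have "\<dots> \<le> 0"
  proof (intro sum_nonpos)
    fix i assume "i \<in> {..<n}"
    then show "g i * ((R *\<^sub>v x) $ i)\<^sup>2 \<le> 0"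
      using y0[of i] by (cases "g i > 0") (auto simp: mult_nonpos_nonneg)
  qed
  finally have le: "(\<Sum>i<n. d i * (x $ i)\<^sup>2) \<le> 0" .
  obtain k where k: "k < n" "x $ k \<noteq> 0" using x by (metis carrier_vecD eq_vecI index_zero_vec(1) zero_carrier_vec)
  have "(\<Sum>i<n. d i * (x $ i)\<^sup>2) > 0"
  proof (rule sum_pos2[of _ k])
    show "0 < d k * (x $ k)\<^sup>2" using k x0[of k] by (cases "d k > 0") auto
    show "0 \<le> d i * (x $ i)\<^sup>2" if "i \<in> {..<n}" for i using x0[of i] that by (cases "d i > 0") auto
  qed (use k in auto)
  then show False using le by simp
qed

lemma inverse_matrix:
  fixes A :: "'a :: field mat"
  assumes "A \<in> carrier_mat n n" "det A \<noteq> 0"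
  obtains Ai where "Ai \<in> carrier_mat n n" "A * Ai = 1\<^sub>m n" "Ai * A = 1\<^sub>m n"
  using det_non_zero_imp_unit[OF assms, of "()"] by (auto simp: Units_def ring_mat_def)

text \<open>The matrix \<open>Pi * Q\<close>, with \<open>Pi\<close> inverse to \<open>P\<close>,
  carries one diagonalization of \<open>K\<close> to the other, so the previous comparison
  applies.\<close>

lemma congruent_diag_card_pos_le:
  fixes K :: "real mat"
  assumes K: "K \<in> carrier_mat n n" and P: "P \<in> carrier_mat n n" and Q: "Q \<in> carrier_mat n n"
    and det: "det P \<noteq> 0"
    and PK: "transpose_mat P * K * P = mat_diag n g" and QK: "transpose_mat Q * K * Q = mat_diag n d"
  shows "card {i. i < n \<and> d i > 0} \<le> card {i. i < n \<and> g i > 0}"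
proof -
  note as = assoc_mult_mat[of _ n n _ n _ n]
  obtain Pi where Pi: "Pi \<in> carrier_mat n n" "P * Pi = 1\<^sub>m n" "Pi * P = 1\<^sub>m n"
    using inverse_matrix[OF P det] .
  have t: "transpose_mat P \<in> carrier_mat n n" "transpose_mat Q \<in> carrier_mat n n"
    "transpose_mat Pi \<in> carrier_mat n n" using P Q Pi by auto
  have tr: "transpose_mat Pi * transpose_mat P = 1\<^sub>m n"
    using transpose_mult[OF P Pi(1)] Pi(2) by simp
  have "transpose_mat (Pi * Q) * mat_diag n g * (Pi * Q)
      = transpose_mat Q * (transpose_mat Pi * transpose_mat P) * K * (P * Pi) * Q"
    unfolding PK[symmetric] transpose_mult[OF Pi(1) Q]
    using P Q Pi(1) K t by (simp add: as)
  then have "transpose_mat (Pi * Q) * mat_diag n g * (Pi * Q) = mat_diag n d"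
    using Q t K by (simp add: tr Pi(2) QK)
  then show ?thesis using Pi Q by (intro sylvester_le) simp_all
qed

text \<open>For an orthogonal diagonalization the positive entries are the positive eigenvalues.
  Comparing it in both directions with the given congruence transfers the count to
  \<open>g\<close>.\<close>

theorem sylvester_num_pos_eig:
  assumes M: "M \<in> carrier_mat n n" and sym: "transpose_mat M = M"
    and P: "P \<in> carrier_mat n n" and det: "det P \<noteq> 0"
    and PMP: "transpose_mat P * M * P = mat_diag n g"
  shows "num_pos_eig M = card {i. i < n \<and> g i > 0}"
proof -
  obtain U d where U: "U \<in> carrier_mat n n" and UU: "transpose_mat U * U = 1\<^sub>m n"
    and UMU: "transpose_mat U * M * U = mat_diag n d"
    using real_symmetric_diagonalization[OF M sym] by blast
  have "det (transpose_mat U) * det U = 1" using det_mult[of "transpose_mat U" n U] U UU by simp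
  then have "det U \<noteq> 0" by auto
  then have "card {i. i < n \<and> d i > 0} = card {i. i < n \<and> g i > 0}"
    using congruent_diag_card_pos_le[OF M P U det PMP UMU] congruent_diag_card_pos_le[OF M U P _ UMU PMP]
    by (simp add: order_antisym)
  then show ?thesis using num_pos_eig_orthogonal_diag[OF M U UU UMU] by simp
qed

section \<open>Canonical form of the pencil\<close>

lemma mult_mat4_index:
  assumes "A \<in> carrier_mat 4 4" "B \<in> carrier_mat 4 4" "i < 4" "j < 4"
  shows "(A * B) $$ (i, j) = A $$ (i, 0) * B $$ (0, j) + A $$ (i, 1) * B $$ (1, j)
    + A $$ (i, 2) * B $$ (2, j) + A $$ (i, 3) * (B $$ (3, j) :: 'a :: comm_ring_1)"
proof -
  have "{0..<4} = {0, 1, 2, 3::nat}" by auto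
  then show ?thesis using assms by (simp add: scalar_prod_def add.assoc)
qed

lemma less_4_cases: "i < (4::nat) \<Longrightarrow> i = 0 \<or> i = 1 \<or> i = 2 \<or> i = 3"
  by auto

lemma mat4_eqI:
  assumes "dim_row A = 4" "dim_col A = 4" "dim_row B = 4" "dim_col B = 4"
    and "A $$ (0, 0) = B $$ (0, 0)" "A $$ (0, 1) = B $$ (0, 1)" "A $$ (0, 2) = B $$ (0, 2)" "A $$ (0, 3) = B $$ (0, 3)"
    and "A $$ (1, 0) = B $$ (1, 0)" "A $$ (1, 1) = B $$ (1, 1)" "A $$ (1, 2) = B $$ (1, 2)" "A $$ (1, 3) = B $$ (1, 3)"
    and "A $$ (2, 0) = B $$ (2, 0)" "A $$ (2, 1) = B $$ (2, 1)" "A $$ (2, 2) = B $$ (2, 2)" "A $$ (2, 3) = B $$ (2, 3)"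
    and "A $$ (3, 0) = B $$ (3, 0)" "A $$ (3, 1) = B $$ (3, 1)" "A $$ (3, 2) = B $$ (3, 2)" "A $$ (3, 3) = B $$ (3, 3)"
  shows "A = B"
proof (rule eq_matI)
  fix i j assume "i < dim_row B" "j < dim_col B"
  then have "i < 4" "j < 4" using assms(3,4) by auto
  then show "A $$ (i, j) = B $$ (i, j)"
    using assms(5-) less_4_cases[of i] less_4_cases[of j] by auto
qed (use assms in auto)

text \<open>Matrices are given by literal lists of rows, so that simplification can evaluate their
  entries and products.\<close>

definition mat4 :: "'a list list \<Rightarrow> 'a mat" where
  "mat4 rs = mat 4 4 (\<lambda>(i, j). rs ! i ! j)"

lemma mat4_carrier [simp]: "mat4 rs \<in> carrier_mat 4 4"
  by (simp add: mat4_def)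

lemma mat4_dim [simp]: "dim_row (mat4 rs) = 4" "dim_col (mat4 rs) = 4"
  by (simp_all add: mat4_def)

lemma mat4_index [simp]: "i < 4 \<Longrightarrow> j < 4 \<Longrightarrow> mat4 rs $$ (i, j) = rs ! i ! j"
  by (simp add: mat4_def)

lemma row_col_mat4 [simp]:
  assumes "i < 4" "j < 4"
  shows "row (mat4 R) i \<bullet> col (mat4 S) j = R ! i ! 0 * S ! 0 ! j + R ! i ! 1 * S ! 1 ! j
    + R ! i ! 2 * S ! 2 ! j + R ! i ! 3 * (S ! 3 ! j :: 'a :: comm_ring_1)"
  using mult_mat4_index[of "mat4 R" "mat4 S" i j] assms by simp

lemma canonA_31_mat4:
  "canonA_31 e e2 = mat4 [[0, 0, of_int e, 0], [0, of_int e, 0, 0], [of_int e, 0, 0, 0],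
     [0, 0, 0, of_int e2]]"
  by (rule mat4_eqI) (simp_all add: canonA_31_def anti_id_def)

lemma jordan_matrix_31:
  "jordan_matrix [(3, l), (1, l)] = mat4 [[l, 1, 0, 0], [0, l, 1, 0], [0, 0, l, 0], [0, 0, 0, l :: real]]"
  by (rule mat4_eqI) (simp_all add: jordan_matrix_def Let_def)

lemma canonB_31_mat4:
  "canonB_31 e e2 l = mat4 [[0, 0, of_int e * l, 0], [0, of_int e * l, of_int e, 0],
     [of_int e * l, of_int e, 0, 0], [0, 0, 0, of_int e2 * l]]"
proof -
  have "{0..<3} = {0, 1, 2::nat}" by auto
  then show ?thesis
    by (intro mat4_eqI)
      (simp_all add: canonB_31_def anti_id_def jordan_block_def scalar_prod_def)
qed

section \<open>Nonsingularity of A and reduction to canonical form\<close>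

text \<open>Both sides of \<open>f\<close> are quartic in \<open>l\<close> with leading coefficients
  \<open>det A\<close> and \<open>c\<close>. These are extracted by reversing the polynomial: put
  \<open>l = 1 / t\<close>, multiply by \<open>t ^ 4\<close> and let \<open>t\<close> tend to
  0.\<close>

lemma det_leading_coefficient:
  fixes A B :: "real mat"
  assumes A: "A \<in> carrier_mat 4 4" and B: "B \<in> carrier_mat 4 4"
    and f: "\<And>l. det (l \<cdot>\<^sub>m A - B) = c * (l - l0) ^ 4"
  shows "det A = c"
proof -
  have eq: "det (A - t \<cdot>\<^sub>m B) = c * (1 - t * l0) ^ 4" if "t \<noteq> 0" for t
  proof -
    have "A - t \<cdot>\<^sub>m B = t \<cdot>\<^sub>m ((1 / t) \<cdot>\<^sub>m A - B)"
      using A B that by (intro eq_matI) (auto simp: field_simps)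
    then have "det (A - t \<cdot>\<^sub>m B) = t ^ 4 * (c * (1 / t - l0) ^ 4)"
      using A B f[of "1 / t"] by simp
    also have "\<dots> = c * (t * (1 / t - l0)) ^ 4" by (simp only: power_mult_distrib mult.left_commute)
    also have "t * (1 / t - l0) = 1 - t * l0" using that by (simp add: field_simps)
    finally show ?thesis .
  qed
  \<comment> \<open>The Leibniz expansion exhibits the determinant as a polynomial in
    \<open>t\<close>, which gives its continuity at 0.\<close>
  have det: "det (A - t \<cdot>\<^sub>m B) = (\<Sum>p\<in>{p. p permutes {0..<4}}.
      signof p * (\<Prod>i = 0..<4. A $$ (i, p i) - t * B $$ (i, p i)))" for t
  proof -
    have "A - t \<cdot>\<^sub>m B \<in> carrier_mat 4 4" using A B by (intro minus_carrier_mat) simp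
    then have "det (A - t \<cdot>\<^sub>m B) = (\<Sum>p\<in>{p. p permutes {0..<4}}.
        signof p * (\<Prod>i = 0..<4. (A - t \<cdot>\<^sub>m B) $$ (i, p i)))" by (rule det_def')
    also have "\<dots> = (\<Sum>p\<in>{p. p permutes {0..<4}}.
        signof p * (\<Prod>i = 0..<4. A $$ (i, p i) - t * B $$ (i, p i)))"
    proof (intro sum.cong prod.cong refl arg_cong2[of _ _ _ _ "(*)"])
      fix p i assume "p \<in> {p. p permutes {0..<4::nat}}" "i \<in> {0..<4::nat}"
      then have "i < 4" "p i < 4" using permutes_in_image[of p "{0..<4}" i] by auto
      then show "(A - t \<cdot>\<^sub>m B) $$ (i, p i) = A $$ (i, p i) - t * B $$ (i, p i)"
        using A B by simp
    qed
    finally show ?thesis .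
  qed
  have "((\<lambda>t. det (A - t \<cdot>\<^sub>m B)) \<longlongrightarrow> det (A - 0 \<cdot>\<^sub>m B)) (at 0)"
    unfolding det by (intro tendsto_intros)
  moreover have "((\<lambda>t. c * (1 - t * l0) ^ 4) \<longlongrightarrow> c * (1 - 0 * l0) ^ 4) (at 0)"
    by (intro tendsto_intros)
  then have "((\<lambda>t. det (A - t \<cdot>\<^sub>m B)) \<longlongrightarrow> c * (1 - 0 * l0) ^ 4) (at 0)"
    by (rule Lim_transform_eventually) (auto simp: eq eventually_at_filter)
  ultimately have "det (A - 0 \<cdot>\<^sub>m B) = c * (1 - 0 * l0) ^ 4"
    by (intro tendsto_unique[OF _ ]) auto
  moreover have "A - 0 \<cdot>\<^sub>m B = A" using A B by (intro eq_matI) auto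
  ultimately show ?thesis by simp
qed

text \<open>Inside the 3x3 block, multiplication by \<open>J\<close> adds to \<open>l\<close> times
  column \<open>j\<close> the column \<open>j - 1\<close>, read as zero for \<open>j = 0\<close>.
  Symmetry of \<open>A\<close> and \<open>A * J\<close> thus gives
  \<open>A $$ (i, j - 1) = A $$ (i - 1, j)\<close>: the antidiagonals are constant and those above
  the main one vanish. Comparison with the fourth column leaves only the coupling entry
  \<open>d\<close>.\<close>

lemma hankel_form:
  fixes A :: "real mat"
  assumes A: "A \<in> carrier_mat 4 4" and sym: "transpose_mat A = A"
    and symJ: "transpose_mat (A * jordan_matrix [(3, l), (1, l)]) = A * jordan_matrix [(3, l), (1, l)]"
  shows "\<exists>a b c d f. A = mat4 [[0, 0, a, 0], [0, a, b, 0], [a, b, c, d], [0, 0, d, f]]"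
proof -
  have s: "A $$ (i, j) = A $$ (j, i)" if "i < 4" "j < 4" for i j
    using that A arg_cong[OF sym, of "\<lambda>X. X $$ (i, j)"] by simp
  have t: "(A * jordan_matrix [(3, l), (1, l)]) $$ (i, j) = (A * jordan_matrix [(3, l), (1, l)]) $$ (j, i)"
    if "i < 4" "j < 4" for i j
    using that A arg_cong[OF symJ, of "\<lambda>X. X $$ (i, j)"] by (simp add: jordan_matrix_31)
  note t = t[unfolded jordan_matrix_31]
  note [simp] = mult_mat4_index[OF A mat4_carrier]
  have "A $$ (0, 0) = 0" using t[of 0 1] s[of 0 1] by simp
  moreover have "A $$ (0, 1) = 0" using t[of 0 2] s[of 0 2] by simp
  moreover have "A $$ (1, 1) = A $$ (0, 2)" using t[of 1 2] s[of 1 2] s[of 0 2] by simp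
  moreover have "A $$ (0, 3) = 0" using t[of 1 3] s[of 1 3] s[of 0 3] by simp
  moreover have "A $$ (1, 3) = 0" using t[of 2 3] s[of 2 3] s[of 1 3] by simp
  ultimately have "A = mat4 [[0, 0, A $$ (0, 2), 0], [0, A $$ (0, 2), A $$ (1, 2), 0],
      [A $$ (0, 2), A $$ (1, 2), A $$ (2, 2), A $$ (2, 3)], [0, 0, A $$ (2, 3), A $$ (3, 3)]]"
    using A s[of 1 0] s[of 2 0] s[of 3 0] s[of 2 1] s[of 3 1] s[of 3 2]
    by (intro mat4_eqI) simp_all
  then show ?thesis by blast
qed

lemma det_mat4_zero:
  assumes "x \<in> carrier_vec 4" "x \<noteq> 0\<^sub>v 4" "A \<in> carrier_mat 4 4" "A *\<^sub>v x = 0\<^sub>v 4"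
  shows "det (A :: real mat) = 0"
  using det_0_iff_vec_prod_zero_field assms by blast

text \<open>The determinant is \<open>- a ^ 3 * f\<close>. Instead of expanding it, a kernel vector
  is exhibited when \<open>a\<close> or \<open>f\<close> vanishes.\<close>

lemma hankel_form_det_nonzero:
  fixes a b c d f :: real
  assumes nz: "det (mat4 [[0, 0, a, 0], [0, a, b, 0], [a, b, c, d], [0, 0, d, f]]) \<noteq> 0"
  shows "a \<noteq> 0 \<and> f \<noteq> 0"
proof -
  have S: "{0..<4} = {0, 1, 2, 3::nat}" by auto
  have a: "a \<noteq> 0"
  proof
    assume "a = 0"
    then have "mat4 [[0, 0, a, 0], [0, a, b, 0], [a, b, c, d], [0, 0, d, f]] *\<^sub>v unit_vec 4 0 = 0\<^sub>v 4"
      by (intro eq_vecI) (auto dest!: less_4_cases)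
    then show False using nz det_mat4_zero[of "unit_vec 4 0"] by fastforce
  qed
  have "f \<noteq> 0"
  proof
    assume "f = 0"
    \<comment> \<open>With \<open>f = 0\<close> the only remaining equation is that of row 2,
      \<open>a * x0 + d = 0\<close>.\<close>
    define x where "x = vec_of_list [- d / a, 0, 0, 1 :: real]"
    have x: "x \<in> carrier_vec 4" unfolding x_def by (intro carrier_vecI) simp
    have "x $ 3 = 1" by (simp add: x_def vec_of_list_index del: vec_of_list_Cons)
    then have "x \<noteq> 0\<^sub>v 4" by auto
    moreover have "mat4 [[0, 0, a, 0], [0, a, b, 0], [a, b, c, d], [0, 0, d, f]] *\<^sub>v x = 0\<^sub>v 4"
      using \<open>f = 0\<close> a x
      by (intro eq_vecI) (auto dest!: less_4_cases simp: scalar_prod_def S x_def vec_of_list_index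
          simp del: vec_of_list_Cons)
    ultimately show False using nz det_mat4_zero[OF x] by fastforce
  qed
  with a show ?thesis by blast
qed

text \<open>With \<open>N\<close> the nilpotent part of \<open>J\<close>, a polynomial
  \<open>p + q N + r N^2\<close> on the 3x3 block commutes with \<open>J\<close>; so does adding to
  the fourth basis vector a multiple of the first, since \<open>N\<close> kills both. These
  parameters suffice: \<open>p\<close> and \<open>s\<close> scale \<open>a\<close> and
  \<open>f\<close> to signs, \<open>q\<close> removes \<open>b\<close>, \<open>r\<close> removes
  \<open>c\<close>, and the extra multiple \<open>- s * d / a\<close> removes
  \<open>d\<close>.\<close>

lemma hankel_form_normalize:
  fixes a b c d f l :: real
  assumes a: "a \<noteq> 0" and f: "f \<noteq> 0"
  defines "H \<equiv> mat4 [[0, 0, a, 0], [0, a, b, 0], [a, b, c, d], [0, 0, d, f]]"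
    and "J \<equiv> jordan_matrix [(3, l), (1, l)]"
  shows "\<exists>R e e2. R \<in> carrier_mat 4 4 \<and> det R \<noteq> 0 \<and> e \<in> {-1, 1} \<and> e2 \<in> {-1, 1}
    \<and> transpose_mat R * H * R = canonA_31 e e2 \<and> J * R = R * J"
proof -
  define e :: int where "e = (if a > 0 then 1 else -1)"
  define e2 :: int where "e2 = (if f > 0 then 1 else -1)"
  define p where "p = 1 / sqrt \<bar>a\<bar>"
  \<comment> \<open>\<open>q\<close> and \<open>r\<close> solve the equations stating that the
    entries \<open>(1, 2)\<close> and \<open>(2, 2)\<close> of the transformed matrix
    vanish.\<close>
  define q where "q = - p * b / (2 * a)"
  define r where "r = - (p\<^sup>2 * c + 2 * p * q * b + q\<^sup>2 * a) / (2 * p * a)"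
  define s where "s = 1 / sqrt \<bar>f\<bar>"
  have p: "p > 0" "p * p * a = of_int e" and s: "s > 0" "s * s * f = of_int e2"
    using a f by (auto simp: p_def s_def e_def e2_def field_simps)
  have q: "2 * (q * a) + b * p = 0" using a by (simp add: q_def)
  have r: "2 * p * r * a = - (p\<^sup>2 * c + 2 * p * q * b + q\<^sup>2 * a)" using a p by (simp add: r_def)
  define R where "R = mat4 [[p, q, r, - s * d / a], [0, p, q, 0], [0, 0, p, 0], [0, 0, 0, s]]"
  have R: "R \<in> carrier_mat 4 4" by (simp add: R_def)
  have "upper_triangular R"
  proof (rule upper_triangularI)
    fix i j assume "j < i" "i < dim_row R"
    then show "R $$ (i, j) = 0"
      using less_4_cases[of i] less_4_cases[of j] by (auto simp: R_def)
  qed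
  then have "det R = prod_list (diag_mat R)" using R by (rule det_upper_triangular)
  also have "\<dots> = p * p * p * s" by (simp add: diag_mat_def R_def upt_rec)
  finally have "det R \<noteq> 0" using p s by simp
  moreover have "transpose_mat R * H * R = canonA_31 e e2"
  proof -
    have HR: "H * R = mat4 [[0, 0, a * p, 0], [0, a * p, a * q + b * p, 0],
      [a * p, a * q + b * p, a * r + b * q + c * p, 0], [0, 0, d * p, f * s]]"
      by (rule mat4_eqI) (use a in \<open>simp_all add: H_def R_def\<close>)
    have Rt: "transpose_mat R = mat4 [[p, 0, 0, 0], [q, p, 0, 0], [r, q, p, 0], [- s * d / a, 0, 0, s]]"
      by (rule mat4_eqI) (simp_all add: R_def)
    have "p * (a * q + b * p) + q * (a * p) = p * (2 * (q * a) + b * p)" by (simp add: algebra_simps)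
    then have "p * (a * q + b * p) + q * (a * p) = 0" unfolding q by simp
    moreover have "r * (a * p) + q * (a * q + b * p) + p * (a * r + b * q + c * p) = 0"
      using r by (simp add: algebra_simps power2_eq_square)
    ultimately have "transpose_mat R * (H * R) = canonA_31 e e2"
      unfolding HR Rt canonA_31_mat4
      using p s a by (intro mat4_eqI) (simp_all add: algebra_simps)
    then show ?thesis using R by (simp add: H_def assoc_mult_mat[of _ 4 4 _ 4 _ 4])
  qed
  moreover have "J * R = R * J"
    unfolding J_def jordan_matrix_31 R_def
    by (rule mat4_eqI) simp_all
  moreover have "e \<in> {-1, 1}" "e2 \<in> {-1, 1}" by (auto simp: e_def e2_def)
  ultimately show ?thesis using R by blast
qed

text \<open>In a Jordan basis \<open>P\<close> of the inverse of \<open>A\<close> times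
  \<open>B\<close>, the pencil becomes \<open>H\<close> and \<open>H * J\<close>, both symmetric, so
  \<open>H\<close> has Hankel form. Because the normalizing \<open>R\<close> commutes with
  \<open>J\<close>, it brings both matrices to canonical form at once.\<close>

theorem canonical_form_31:
  fixes A B :: "real mat"
  assumes A: "A \<in> carrier_mat 4 4" and B: "B \<in> carrier_mat 4 4"
    and symA: "transpose_mat A = A" and symB: "transpose_mat B = B"
    and det: "det A \<noteq> 0" and segre: "segre_31 A B l0"
  shows "\<exists>Q e e2. Q \<in> carrier_mat 4 4 \<and> det Q \<noteq> 0 \<and> e \<in> {-1, 1} \<and> e2 \<in> {-1, 1}
    \<and> transpose_mat Q * A * Q = canonA_31 e e2 \<and> transpose_mat Q * B * Q = canonB_31 e e2 l0"
proof -
  note as = assoc_mult_mat[of _ 4 4 _ 4 _ 4]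
  define J where "J = jordan_matrix [(3, l0), (1, l0)]"
  have J: "J \<in> carrier_mat 4 4" unfolding J_def jordan_matrix_31 by simp
  obtain Ai where some: "mat_inverse A = Some Ai"
    using mat_inverse(1)[OF A, of "()"] det_non_zero_imp_unit[OF A det, of "()"] by (cases "mat_inverse A") auto
  have Ai: "Ai \<in> carrier_mat 4 4" "A * Ai = 1\<^sub>m 4" using mat_inverse(2)[OF A some] by auto
  have "similar_mat (Ai * B) J" using segre by (simp add: segre_31_def some jordan_nf_def J_def)
  then obtain P P' where "similar_mat_wit (Ai * B) J P P'" unfolding similar_mat_def by blast
  moreover have "Ai * B \<in> carrier_mat 4 4" using Ai B by simp
  ultimately
  have P: "P \<in> carrier_mat 4 4" and P': "P' \<in> carrier_mat 4 4" and PP': "P * P' = 1\<^sub>m 4"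
    and P'P: "P' * P = 1\<^sub>m 4" and sim: "Ai * B = P * J * P'"
    using similar_mat_witD2[of "Ai * B" 4 4 J P P'] by auto
  have Pt: "transpose_mat P \<in> carrier_mat 4 4" using P by simp
  have "B * P = (A * Ai) * B * P" using B P by (simp add: Ai)
  also have "\<dots> = A * (Ai * B) * P" using A Ai(1) B P by (simp add: as)
  also have "\<dots> = A * P * J * (P' * P)" unfolding sim using A P P' J by (simp add: as)
  also have "\<dots> = A * P * J" using A P J by (simp add: P'P)
  finally have BP: "B * P = A * P * J" .
  define H where "H = transpose_mat P * A * P"
  have H: "H \<in> carrier_mat 4 4" using P A by (simp add: H_def)
  have HJ: "transpose_mat P * B * P = H * J"
    using P Pt A B J BP by (simp add: H_def as)
  have "transpose_mat H = H"
    using P Pt A by (simp add: H_def transpose_mult[of _ 4 4 _ 4] symA as)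
  moreover have "transpose_mat (H * J) = H * J"
    unfolding HJ[symmetric] using P Pt B by (simp add: transpose_mult[of _ 4 4 _ 4] symB as)
  ultimately obtain a b c d f where
    Hm: "H = mat4 [[0, 0, a, 0], [0, a, b, 0], [a, b, c, d], [0, 0, d, f]]"
    using hankel_form[OF H] unfolding J_def by blast
  have "det P * det P' = 1" using det_mult[OF P P'] PP' by simp
  then have dP: "det P \<noteq> 0" by auto
  have "det H = det P * det A * det P"
    unfolding H_def using P Pt A by (simp add: det_mult[of _ 4] det_transpose[OF P])
  then have "det H \<noteq> 0" using dP det by simp
  then have "a \<noteq> 0" "f \<noteq> 0" using hankel_form_det_nonzero unfolding Hm by blast+
  then obtain R e e2 where R: "R \<in> carrier_mat 4 4" and dR: "det R \<noteq> 0"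
    and e: "e \<in> {-1, 1}" "e2 \<in> {-1, 1}"
    and RHR: "transpose_mat R * H * R = canonA_31 e e2" and comm: "J * R = R * J"
    using hankel_form_normalize[of a f b c d l0] unfolding Hm J_def by blast
  have Rt: "transpose_mat R \<in> carrier_mat 4 4" using R by simp
  have "transpose_mat (P * R) * A * (P * R) = canonA_31 e e2"
    using P Pt R Rt A RHR by (simp add: transpose_mult[OF P R] as H_def)
  moreover have "transpose_mat (P * R) * B * (P * R) = canonB_31 e e2 l0"
  proof -
    have "transpose_mat (P * R) * B * (P * R) = transpose_mat R * (transpose_mat P * B * P) * R"
      using P Pt R Rt B by (simp add: transpose_mult[OF P R] as)
    \<comment> \<open>Commutation moves \<open>J\<close> to the right of \<open>R\<close>, where it
      meets the already normalized \<open>H\<close>.\<close>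
    also have "\<dots> = transpose_mat R * H * (J * R)" unfolding HJ using H J R Rt by (simp add: as)
    also have "\<dots> = canonA_31 e e2 * J"
      unfolding comm RHR[symmetric] using H J R Rt by (simp add: as)
    also have "\<dots> = canonB_31 e e2 l0"
      unfolding canonA_31_mat4 canonB_31_mat4 J_def jordan_matrix_31
      by (rule mat4_eqI) simp_all
    finally show ?thesis .
  qed
  moreover have "det (P * R) \<noteq> 0" using dP dR by (simp add: det_mult[OF P R])
  ultimately show ?thesis using P R e by (intro exI[of _ "P * R"] exI[of _ e] exI[of _ e2]) auto
qed


section \<open>Sign of the 3x3 block and the index sequence\<close>

text \<open>The sign of the 3x3 block is read off the congruence-covariant form \<open>C A\<^sup>-\<^sup>1 C\<close> with
  \<open>C = B - l A\<close>, which becomes \<open>e x\<^sub>2\<^sup>2\<close> in canonical coordinates.\<close>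

lemma sign_form:
  fixes A B Q :: "real mat"
  assumes A: "A \<in> carrier_mat 4 4" and B: "B \<in> carrier_mat 4 4" and Q: "Q \<in> carrier_mat 4 4"
    and det: "det Q \<noteq> 0" and Ai: "Ai \<in> carrier_mat 4 4" "Ai * A = 1\<^sub>m 4"
    and e: "e \<in> {-1, 1}" "e2 \<in> {-1, 1}"
    and QA: "transpose_mat Q * A * Q = canonA_31 e e2"
    and QB: "transpose_mat Q * B * Q = canonB_31 e e2 l"
  shows "transpose_mat Q * ((B - l \<cdot>\<^sub>m A) * Ai * (B - l \<cdot>\<^sub>m A)) * Q
    = mat_diag 4 (\<lambda>i. if i = 2 then of_int e else 0)"
proof -
  note as = assoc_mult_mat[of _ 4 4 _ 4 _ 4]
  obtain Qi where Qi: "Qi \<in> carrier_mat 4 4" "Q * Qi = 1\<^sub>m 4" "Qi * Q = 1\<^sub>m 4"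
    using inverse_matrix[OF Q det] .
  have Qt: "transpose_mat Q \<in> carrier_mat 4 4" and Qit: "transpose_mat Qi \<in> carrier_mat 4 4"
    using Q Qi by auto
  have tr: "transpose_mat Qi * transpose_mat Q = 1\<^sub>m 4"
    using transpose_mult[OF Q Qi(1)] Qi(2) by simp
  define D where "D = canonA_31 e e2"
  have D: "D \<in> carrier_mat 4 4" by (simp add: D_def canonA_31_mat4)
  have DD: "D * D = 1\<^sub>m 4"
    unfolding D_def canonA_31_mat4 using e by (intro mat4_eqI) auto
  \<comment> \<open>Since \<open>D\<close> is an involution, \<open>Q * D * transpose_mat Q\<close>
    is inverse to \<open>A\<close>. This expresses \<open>Ai\<close> through the canonical
    basis.\<close>
  have "A * Q * D * transpose_mat Q = transpose_mat Qi * (transpose_mat Q * A * Q) * D * transpose_mat Q"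
  proof -
    have "transpose_mat Qi * (transpose_mat Q * A * Q) * D * transpose_mat Q
      = (transpose_mat Qi * transpose_mat Q) * (A * Q * D * transpose_mat Q)"
      using A Q Qt Qit D by (simp add: as)
    then show ?thesis using A Q Qt D by (simp add: tr)
  qed
  also have "\<dots> = transpose_mat Qi * (D * D) * transpose_mat Q"
    unfolding QA D_def[symmetric] using Qit D Qt by (simp add: as)
  also have "\<dots> = 1\<^sub>m 4" using Qit by (simp add: DD tr)
  finally have "A * (Q * D * transpose_mat Q) = 1\<^sub>m 4" using A Q Qt D by (simp add: as)
  then have "Ai * (A * (Q * D * transpose_mat Q)) = Ai" using Ai by simp
  then have "(Ai * A) * (Q * D * transpose_mat Q) = Ai" using A Q Qt D Ai(1) by (simp add: as)
  then have Aieq: "Ai = Q * D * transpose_mat Q" using Q D Qt unfolding Ai(2) by simp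
  define C where "C = B - l \<cdot>\<^sub>m A"
  have C: "C \<in> carrier_mat 4 4" unfolding C_def using A B by (intro minus_carrier_mat) simp
  have "transpose_mat Q * C * Q = transpose_mat Q * B * Q - l \<cdot>\<^sub>m (transpose_mat Q * A * Q)"
    unfolding C_def using A B Q Qt
    by (simp add: mult_minus_distrib_mat[of _ 4 4 _ 4] minus_mult_distrib_mat[of _ 4 4 _ _ 4]
        mult_smult_distrib[of _ 4 4 _ 4] mult_smult_assoc_mat[of _ 4 4 _ 4])
  also have "\<dots> = mat4 [[0, 0, 0, 0], [0, 0, of_int e, 0], [0, of_int e, 0, 0], [0, 0, 0, 0]]"
    unfolding QA QB canonA_31_mat4 canonB_31_mat4 by (rule mat4_eqI) simp_all
  finally have QC: "transpose_mat Q * C * Q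
    = mat4 [[0, 0, 0, 0], [0, 0, of_int e, 0], [0, of_int e, 0, 0], [0, 0, 0, 0]]" .
  have "transpose_mat Q * (C * Ai * C) * Q = (transpose_mat Q * C * Q) * D * (transpose_mat Q * C * Q)"
    unfolding Aieq using C Q Qt D by (simp add: as)
  also have "\<dots> = mat_diag 4 (\<lambda>i. if i = 2 then of_int e else 0)"
  proof -
    have "(of_int e :: real) * of_int e = 1" using e by auto
    then have "mat4 [[0, 0, 0, 0], [0, 0, of_int e, 0], [0, of_int e, 0, 0], [0, 0, 0, 0]] * D
      = mat4 [[0, 0, 0, 0], [1, 0, 0, 0], [0, 1, 0, 0], [0, 0, 0, 0]]"
      unfolding D_def canonA_31_mat4 by (intro mat4_eqI) simp_all
    then show ?thesis unfolding QC
      by (intro mat4_eqI) (simp_all add: mat_diag_def)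
  qed
  finally show ?thesis unfolding C_def .
qed

lemma card_pos_less_4:
  fixes g :: "nat \<Rightarrow> real"
  shows "card {i. i < 4 \<and> g i > 0} = (if g 0 > 0 then 1 else 0) + (if g 1 > 0 then 1 else 0)
    + (if g 2 > 0 then 1 else 0) + (if g 3 > 0 then 1 else 0)"
proof -
  have "card {i. i < 4 \<and> g i > 0} = (\<Sum>i<4. if g i > 0 then 1 else 0)"
    by (simp add: sum.If_cases Int_def)
  also have "{..<4} = {0, 1, 2, 3 :: nat}" by auto
  finally show ?thesis by simp
qed

text \<open>Uniqueness is the point: \<open>K\<close> is defined from \<open>A\<close>,
  \<open>B\<close> and \<open>l\<close> alone, while two reductions diagonalize it with single
  nonzero entries \<open>e\<close> and \<open>e'\<close>. The law of inertia forces these signs to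
  agree.\<close>

lemma sign_block3_eq:
  fixes A B Q :: "real mat"
  assumes A: "A \<in> carrier_mat 4 4" and B: "B \<in> carrier_mat 4 4" and detA: "det A \<noteq> 0"
    and Q: "Q \<in> carrier_mat 4 4" "det Q \<noteq> 0" and e: "e \<in> {-1, 1}" "e2 \<in> {-1, 1}"
    and QA: "transpose_mat Q * A * Q = canonA_31 e e2"
    and QB: "transpose_mat Q * B * Q = canonB_31 e e2 l"
  shows "sign_block3 A B l = e"
  unfolding sign_block3_def
proof (rule the_equality)
  show "e \<in> {-1, 1} \<and> (\<exists>Q e2. Q \<in> carrier_mat 4 4 \<and> det Q \<noteq> 0 \<and> e2 \<in> {-1, 1}
    \<and> transpose_mat Q * A * Q = canonA_31 e e2 \<and> transpose_mat Q * B * Q = canonB_31 e e2 l)"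
    using assms by blast
next
  fix e' :: int
  assume "e' \<in> {-1, 1} \<and> (\<exists>Q e2. Q \<in> carrier_mat 4 4 \<and> det Q \<noteq> 0 \<and> e2 \<in> {-1, 1}
    \<and> transpose_mat Q * A * Q = canonA_31 e' e2 \<and> transpose_mat Q * B * Q = canonB_31 e' e2 l)"
  then obtain P e2' where e': "e' \<in> {-1, 1}" "e2' \<in> {-1, 1}" and P: "P \<in> carrier_mat 4 4" "det P \<noteq> 0"
    and PA: "transpose_mat P * A * P = canonA_31 e' e2'"
    and PB: "transpose_mat P * B * P = canonB_31 e' e2' l" by blast
  obtain Ai where Ai: "Ai \<in> carrier_mat 4 4" "Ai * A = 1\<^sub>m 4"
    using inverse_matrix[OF A detA] by blast
  define K where "K = (B - l \<cdot>\<^sub>m A) * Ai * (B - l \<cdot>\<^sub>m A)"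
  have "B - l \<cdot>\<^sub>m A \<in> carrier_mat 4 4" using A B by (intro minus_carrier_mat) simp
  then have K: "K \<in> carrier_mat 4 4" using Ai by (simp add: K_def)
  note f = sign_form[OF A B Q Ai e QA QB, folded K_def]
  note f' = sign_form[OF A B P Ai e' PA PB, folded K_def]
  show "e' = e"
    using congruent_diag_card_pos_le[OF K Q(1) P(1) Q(2) f f'] congruent_diag_card_pos_le[OF K P(1) Q(1) P(2) f' f] e e'
    unfolding card_pos_less_4 by auto
qed

lemma Id_pencil_canonical:
  fixes A B Q :: "real mat"
  assumes A: "A \<in> carrier_mat 4 4" and B: "B \<in> carrier_mat 4 4"
    and symA: "transpose_mat A = A" and symB: "transpose_mat B = B"
    and Q: "Q \<in> carrier_mat 4 4" "det Q \<noteq> 0"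
    and QA: "transpose_mat Q * A * Q = canonA_31 e e2"
    and QB: "transpose_mat Q * B * Q = canonB_31 e e2 l0"
    and l: "l \<noteq> l0"
  defines "g \<equiv> nth [of_int e * (l - l0) ^ 3, of_int e * (l - l0), - of_int e / (l - l0), of_int e2 * (l - l0)]"
  shows "Id_pencil A B l = card {i. i < 4 \<and> g i > 0}"
proof -
  note as = assoc_mult_mat[of _ 4 4 _ 4 _ 4]
  define m where "m = l - l0"
  have m: "m \<noteq> 0" using l by (simp add: m_def)
  define M where "M = l \<cdot>\<^sub>m A - B"
  have M: "M \<in> carrier_mat 4 4" unfolding M_def using A B by (intro minus_carrier_mat) simp
  have Qt: "transpose_mat Q \<in> carrier_mat 4 4" using Q by simp
  have "M $$ (i, j) = M $$ (j, i)" if "i < 4" "j < 4" for i j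
    using that A B arg_cong[OF symA, of "\<lambda>X. X $$ (i, j)"] arg_cong[OF symB, of "\<lambda>X. X $$ (i, j)"]
    by (simp add: M_def)
  then have sym: "transpose_mat M = M" using M by (intro eq_matI) auto
  have "transpose_mat Q * M * Q = l \<cdot>\<^sub>m (transpose_mat Q * A * Q) - transpose_mat Q * B * Q"
    unfolding M_def using A B Q Qt
    by (simp add: mult_minus_distrib_mat[of _ 4 4 _ 4] minus_mult_distrib_mat[of _ 4 4 _ _ 4]
        mult_smult_distrib[of _ 4 4 _ 4] mult_smult_assoc_mat[of _ 4 4 _ 4])
  also have "\<dots> = mat4 [[0, 0, of_int e * m, 0], [0, of_int e * m, - of_int e, 0],
      [of_int e * m, - of_int e, 0, 0], [0, 0, 0, of_int e2 * m]]" (is "_ = ?N")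
    unfolding QA QB canonA_31_mat4 canonB_31_mat4 m_def by (rule mat4_eqI) (simp_all add: algebra_simps)
  finally have QMQ: "transpose_mat Q * M * Q = ?N" .
  \<comment> \<open>The columns of \<open>S\<close> are orthogonal for the form \<open>?N\<close>:
    \<open>(0, 1/m, 1, 0)\<close> is the third basis vector corrected by the second, and
    \<open>?N\<close> sends \<open>(1, m, m^2, 0)\<close> to \<open>e * m ^ 3\<close> times the
    first unit vector. The matrix \<open>Si\<close> serves to show that \<open>S\<close> is
    invertible.\<close>
  define S where "S = mat4 [[1, 0, 0, 0], [m, 1, 1 / m, 0], [m\<^sup>2, 0, 1, 0], [0, 0, 0, 1]]"
  define Si where "Si = mat4 [[1, 0, 0, 0], [0, 1, - 1 / m, 0], [- (m\<^sup>2), 0, 1, 0], [0, 0, 0, 1]]"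
  have S: "S \<in> carrier_mat 4 4" and Si: "Si \<in> carrier_mat 4 4" by (simp_all add: S_def Si_def)
  have St: "transpose_mat S = mat4 [[1, m, m\<^sup>2, 0], [0, 1, 0, 0], [0, 1 / m, 1, 0], [0, 0, 0, 1]]"
    by (rule mat4_eqI) (simp_all add: S_def)
  have St': "transpose_mat S \<in> carrier_mat 4 4" using S by simp
  have "S * Si = 1\<^sub>m 4"
    unfolding S_def Si_def using m by (intro mat4_eqI) (simp_all add: power2_eq_square)
  then have "det S * det Si = 1" using det_mult[OF S Si] by simp
  then have "det (Q * S) \<noteq> 0" using Q det_mult[OF Q(1) S] by auto
  moreover have "transpose_mat (Q * S) * M * (Q * S) = mat_diag 4 g"
  proof -
    have "transpose_mat (Q * S) * M * (Q * S) = transpose_mat S * (?N * S)"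
      unfolding QMQ[symmetric] using Q Qt S St' M by (simp add: transpose_mult[OF Q(1) S] as)
    also have "?N * S = mat4 [[of_int e * m ^ 3, 0, of_int e * m, 0], [0, of_int e * m, 0, 0],
        [0, - of_int e, - of_int e / m, 0], [0, 0, 0, of_int e2 * m]]"
      unfolding S_def using m by (intro mat4_eqI) (simp_all add: power2_eq_square power3_eq_cube)
    also have "transpose_mat S * \<dots> = mat_diag 4 g"
      unfolding St g_def m_def[symmetric] using m
      by (intro mat4_eqI) (simp_all add: mat_diag_def power2_eq_square)
    finally show ?thesis .
  qed
  ultimately show ?thesis
    unfolding Id_pencil_def M_def[symmetric] using Q S M sym
    by (intro sylvester_num_pos_eig) simp_all
qed

lemma The_eventually_const:
  assumes "F \<noteq> bot" "\<forall>\<^sub>F x in F. f x = c"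
  shows "(THE s. \<forall>\<^sub>F x in F. f x = s) = c"
proof (rule the_equality)
  show "\<forall>\<^sub>F x in F. f x = c" by fact
next
  fix s assume "\<forall>\<^sub>F x in F. f x = s"
  with assms(2) have "\<forall>\<^sub>F x in F. s = c" by eventually_elim simp
  then show "s = c" using assms(1) by simp
qed

text \<open>Of the diagonal entries coming from the 3x3 block, two have the sign of
  \<open>e * (l - l0)\<close> and one the opposite sign. The last entry has the sign of
  \<open>e2 * (l - l0)\<close>. For \<open>e2 = - e\<close> this balances to two and two on both
  sides of the root; otherwise the split is three to one and reverses at the root.\<close>

lemma index_seq_canonical:
  fixes A B Q :: "real mat"
  assumes A: "A \<in> carrier_mat 4 4" and B: "B \<in> carrier_mat 4 4" and detA: "det A \<noteq> 0"
    and sym: "transpose_mat A = A" "transpose_mat B = B"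
    and Q: "Q \<in> carrier_mat 4 4" "det Q \<noteq> 0" and e: "e \<in> {-1, 1}" "e2 \<in> {-1, 1}"
    and QA: "transpose_mat Q * A * Q = canonA_31 e e2"
    and QB: "transpose_mat Q * B * Q = canonB_31 e e2 l0"
  shows "index_seq A B l0 = (if e2 = - e then (2, e, 2) else if e = 1 then (1, 1, 3) else (3, -1, 1))"
proof -
  note Id = Id_pencil_canonical[OF A B sym Q QA QB, unfolded card_pos_less_4]
  have left: "Id_pencil A B l = (if e2 = - e then 2 else if e = 1 then 1 else 3)" if "l < l0" for l
    using Id[of l] that e by (auto simp: power3_eq_cube zero_less_mult_iff mult_less_0_iff zero_less_divide_iff divide_less_0_iff)
  have right: "Id_pencil A B l = (if e2 = - e then 2 else if e = 1 then 3 else 1)" if "l > l0" for l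
    using Id[of l] that e by (auto simp: power3_eq_cube zero_less_mult_iff mult_less_0_iff zero_less_divide_iff divide_less_0_iff)
  have "(THE s. \<forall>\<^sub>F l in at_left l0. Id_pencil A B l = s) = (if e2 = - e then 2 else if e = 1 then 1 else 3)"
    by (rule The_eventually_const) (auto simp: eventually_at_filter left)
  moreover have "(THE s. \<forall>\<^sub>F l in at_right l0. Id_pencil A B l = s) = (if e2 = - e then 2 else if e = 1 then 3 else 1)"
    by (rule The_eventually_const) (auto simp: eventually_at_filter right)
  ultimately show ?thesis
    unfolding index_seq_def sign_block3_eq[OF A B detA Q e QA QB] using e by auto
qed

section \<open>Geometry of the intersection curve\<close>

lemma cmat_carrier [simp]: "M \<in> carrier_mat n m \<Longrightarrow> cmat M \<in> carrier_mat n m"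
  by (simp add: cmat_def)

lemma cvec_carrier [simp]: "v \<in> carrier_vec n \<Longrightarrow> cvec v \<in> carrier_vec n"
  by (simp add: cvec_def)

lemma cmat_mult: "M \<in> carrier_mat n m \<Longrightarrow> N \<in> carrier_mat m k \<Longrightarrow> cmat (M * N) = cmat M * cmat N"
  unfolding cmat_def by (rule of_real_hom.mat_hom_mult)

lemma cmat_mult_vec: "M \<in> carrier_mat n m \<Longrightarrow> v \<in> carrier_vec m \<Longrightarrow> cmat M *\<^sub>v cvec v = cvec (M *\<^sub>v v)"
  unfolding cmat_def cvec_def by (rule of_real_hom.mult_mat_vec_hom[symmetric])

lemma cmat_one: "cmat (1\<^sub>m n) = 1\<^sub>m n"
  by (rule eq_matI) (auto simp: cmat_def)

lemma cmat_transpose: "cmat (transpose_mat M) = transpose_mat (cmat M)"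
  by (simp add: cmat_def map_mat_transpose)

lemma conj_vec_cmat:
  assumes "M \<in> carrier_mat n m" "v \<in> carrier_vec m"
  shows "conj_vec (cmat M *\<^sub>v v) = cmat M *\<^sub>v conj_vec v"
  using assms by (intro eq_vecI) (auto simp: conj_vec_def cmat_def scalar_prod_def)

lemma conj_vec_carrier [simp]: "v \<in> carrier_vec n \<Longrightarrow> conj_vec v \<in> carrier_vec n"
  by (simp add: conj_vec_def)

lemma line_carrier: "is_line L \<Longrightarrow> L \<subseteq> carrier_vec 4"
  by (auto simp: is_line_def span_line_def)

lemma is_real_line_is_line: "is_real_line L \<Longrightarrow> is_line L"
  unfolding is_real_line_def is_line_def using cvec_carrier by blast

text \<open>A real change of coordinates acting on complex points. It preserves lines, real lines,
  real conics and real points and commutes with conjugation, so the geometric claims need checking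
  only for the canonical pencil.\<close>

locale real_projectivity =
  fixes Q Qi :: "real mat"
  assumes Q: "Q \<in> carrier_mat 4 4" and Qi: "Qi \<in> carrier_mat 4 4"
    and QQi: "Q * Qi = 1\<^sub>m 4" and QiQ: "Qi * Q = 1\<^sub>m 4"
begin

abbreviation S :: "complex vec \<Rightarrow> complex vec" where "S v \<equiv> cmat Q *\<^sub>v v"

abbreviation Si :: "complex vec \<Rightarrow> complex vec" where "Si v \<equiv> cmat Qi *\<^sub>v v"

lemma S_carrier: "v \<in> carrier_vec 4 \<Longrightarrow> S v \<in> carrier_vec 4"
  using Q by (intro mult_mat_vec_carrier[of _ 4 4]) auto

lemma Si_carrier: "v \<in> carrier_vec 4 \<Longrightarrow> Si v \<in> carrier_vec 4"
  using Qi by (intro mult_mat_vec_carrier[of _ 4 4]) auto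

lemma Si_S: "v \<in> carrier_vec 4 \<Longrightarrow> Si (S v) = v"
  using assoc_mult_mat_vec[OF cmat_carrier[OF Qi] cmat_carrier[OF Q], of v]
  by (simp add: QiQ cmat_one flip: cmat_mult[OF Qi Q])

lemma S_Si: "v \<in> carrier_vec 4 \<Longrightarrow> S (Si v) = v"
  using assoc_mult_mat_vec[OF cmat_carrier[OF Q] cmat_carrier[OF Qi], of v]
  by (simp add: QQi cmat_one flip: cmat_mult[OF Q Qi])

lemma S_zero: "S (0\<^sub>v 4) = 0\<^sub>v 4"
  using carrier_matD[OF cmat_carrier[OF Q]] by (intro eq_vecI) (simp_all add: scalar_prod_def)

lemma S_eq_zero: "v \<in> carrier_vec 4 \<Longrightarrow> S v = 0\<^sub>v 4 \<longleftrightarrow> v = 0\<^sub>v 4"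
proof
  assume v: "v \<in> carrier_vec 4" and 0: "S v = 0\<^sub>v 4"
  have "Si (0\<^sub>v 4) = 0\<^sub>v 4" using cmat_carrier[OF Qi] by (intro eq_vecI) auto
  then show "v = 0\<^sub>v 4" using Si_S[OF v] by (simp add: 0)
qed (simp add: S_zero)

lemma S_lincomb2:
  "u \<in> carrier_vec 4 \<Longrightarrow> v \<in> carrier_vec 4 \<Longrightarrow> S (a \<cdot>\<^sub>v u + b \<cdot>\<^sub>v v) = a \<cdot>\<^sub>v S u + b \<cdot>\<^sub>v S v"
  using cmat_carrier[OF Q] by (simp add: mult_add_distrib_mat_vec[of _ 4 4] mult_mat_vec[of _ 4 4])

lemma S_lincomb3:
  "u \<in> carrier_vec 4 \<Longrightarrow> v \<in> carrier_vec 4 \<Longrightarrow> w \<in> carrier_vec 4 \<Longrightarrow>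
    S (a \<cdot>\<^sub>v u + b \<cdot>\<^sub>v v + c \<cdot>\<^sub>v w) = a \<cdot>\<^sub>v S u + b \<cdot>\<^sub>v S v + c \<cdot>\<^sub>v S w"
  using cmat_carrier[OF Q] by (simp del: assoc_add_vec add: mult_add_distrib_mat_vec[of _ 4 4] mult_mat_vec[of _ 4 4])

lemma S_quadratic_form:
  assumes M: "M \<in> carrier_mat 4 4" and v: "v \<in> carrier_vec 4"
  shows "S v \<bullet> (cmat M *\<^sub>v S v) = v \<bullet> (cmat (transpose_mat Q * M * Q) *\<^sub>v v)"
proof -
  have Qt: "transpose_mat Q \<in> carrier_mat 4 4" using Q by simp
  note c = cmat_carrier[OF Q] cmat_carrier[OF Qt] cmat_carrier[OF M]
  have MS: "cmat M *\<^sub>v S v \<in> carrier_vec 4" using c(3) S_carrier[OF v] by simp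
  have "cmat (transpose_mat Q * M * Q) = cmat (transpose_mat Q) * cmat M * cmat Q"
    using Q Qt M by (simp add: cmat_mult[OF _ Q, of _ 4] cmat_mult[OF Qt M] del: assoc_mult_mat)
  then have "cmat (transpose_mat Q * M * Q) *\<^sub>v v = cmat (transpose_mat Q) *\<^sub>v (cmat M *\<^sub>v S v)"
    using c v S_carrier[OF v] by (simp add: assoc_mult_mat_vec[of _ 4 4 _ 4])
  then show ?thesis
    using adjoint_scalar_prod[OF c(2) MS v] by (simp add: cmat_transpose)
qed

text \<open>Substituting \<open>X = S Y\<close> replaces each quadratic form by its congruent
  one.\<close>

lemma qsic_image:
  assumes A: "A \<in> carrier_mat 4 4" and B: "B \<in> carrier_mat 4 4"
  shows "qsic A B = S ` qsic (transpose_mat Q * A * Q) (transpose_mat Q * B * Q)"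
proof (intro equalityI subsetI)
  fix X assume X: "X \<in> qsic A B"
  then have Xc: "X \<in> carrier_vec 4" by (simp add: qsic_def)
  have "Si X \<in> qsic (transpose_mat Q * A * Q) (transpose_mat Q * B * Q)"
    using X S_quadratic_form[OF A Si_carrier[OF Xc]] S_quadratic_form[OF B Si_carrier[OF Xc]]
      Si_carrier[OF Xc] S_eq_zero[OF Si_carrier[OF Xc]]
    by (simp add: qsic_def S_Si)
  then show "X \<in> S ` qsic (transpose_mat Q * A * Q) (transpose_mat Q * B * Q)"
    using S_Si[OF Xc] by (metis image_eqI)
next
  fix X assume "X \<in> S ` qsic (transpose_mat Q * A * Q) (transpose_mat Q * B * Q)"
  then show "X \<in> qsic A B"
    using S_quadratic_form[OF A] S_quadratic_form[OF B] S_carrier S_eq_zero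
    by (auto simp: qsic_def)
qed

lemma S_span_line:
  assumes "u \<in> carrier_vec 4" "v \<in> carrier_vec 4"
  shows "S ` span_line u v = span_line (S u) (S v)"
  unfolding span_line_def using S_lincomb2[OF assms] by (auto simp: image_iff) metis+

lemma S_conic_set:
  assumes "p \<in> carrier_vec 4" "q \<in> carrier_vec 4" "r \<in> carrier_vec 4"
  shows "S ` conic_set p q r M = conic_set (S p) (S q) (S r) M"
  unfolding conic_set_def using S_lincomb3[OF assms] by (auto simp: image_iff) metis+

lemma S_lin_indep2:
  assumes "u \<in> carrier_vec 4" "v \<in> carrier_vec 4" "lin_indep2 u v"
  shows "lin_indep2 (S u) (S v)"
  using assms(3) S_eq_zero unfolding lin_indep2_def S_lincomb2[OF assms(1,2), symmetric]
  by (simp add: assms(1,2))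

lemma S_lin_indep3:
  assumes "u \<in> carrier_vec 4" "v \<in> carrier_vec 4" "w \<in> carrier_vec 4" "lin_indep3 u v w"
  shows "lin_indep3 (S u) (S v) (S w)"
  using assms(4) S_eq_zero unfolding lin_indep3_def S_lincomb3[OF assms(1-3), symmetric]
  by (simp add: assms(1-3))

lemma S_is_line: "is_line L \<Longrightarrow> is_line (S ` L)"
  unfolding is_line_def using S_span_line S_lin_indep2 S_carrier by metis

lemma Q_carrier: "v \<in> carrier_vec 4 \<Longrightarrow> Q *\<^sub>v v \<in> carrier_vec 4"
  using Q by simp

lemma S_cvec: "v \<in> carrier_vec 4 \<Longrightarrow> S (cvec v) = cvec (Q *\<^sub>v v)"
  by (rule cmat_mult_vec[OF Q])

lemma S_is_real_line: "is_real_line L \<Longrightarrow> is_real_line (S ` L)"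
  unfolding is_real_line_def
  by (metis S_span_line S_lin_indep2 Q_carrier S_cvec cvec_carrier)

lemma S_is_real_conic: "is_real_conic C \<Longrightarrow> is_real_conic (S ` C)"
  unfolding is_real_conic_def
  by (elim exE conjE, rule exI, rule exI, rule exI, rule exI)
    (intro conjI; (erule Q_carrier)?; (simp add: S_conic_set S_lin_indep3 flip: S_cvec)?)

lemma S_is_real_point: "is_real_point X \<Longrightarrow> is_real_point (S X)"
  unfolding is_real_point_def by (metis S_cvec Q_carrier)

lemma S_image_eq:
  assumes "L \<subseteq> carrier_vec 4" "L' \<subseteq> carrier_vec 4" "S ` L = S ` L'"
  shows "L = L'"
proof -
  have "inj_on S (carrier_vec 4)" by (rule inj_on_inverseI[of _ Si]) (rule Si_S)
  then show ?thesis using assms by (metis inj_on_image_eq_iff)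
qed

lemma qsic_conic_two_real_lines_transfer:
  assumes A: "A \<in> carrier_mat 4 4" and B: "B \<in> carrier_mat 4 4"
    and can: "qsic_conic_two_real_lines (transpose_mat Q * A * Q) (transpose_mat Q * B * Q)"
  shows "qsic_conic_two_real_lines A B"
proof -
  obtain C L1 L2 X where h: "is_real_conic C" "is_real_line L1" "is_real_line L2" "L1 \<noteq> L2"
    "qsic (transpose_mat Q * A * Q) (transpose_mat Q * B * Q) = C \<union> L1 \<union> L2"
    "is_real_point X" "X \<in> C" "X \<in> L1" "X \<in> L2"
    using can unfolding qsic_conic_two_real_lines_def by blast
  have "S ` L1 \<noteq> S ` L2"
    using S_image_eq[OF line_carrier line_carrier] h is_real_line_is_line by blast
  moreover have "qsic A B = S ` C \<union> S ` L1 \<union> S ` L2" by (simp add: qsic_image[OF A B] h(5) image_Un)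
  ultimately show ?thesis
    unfolding qsic_conic_two_real_lines_def
    using h S_is_real_conic S_is_real_line S_is_real_point by (meson imageI)
qed

lemma qsic_conic_conj_lines_transfer:
  assumes A: "A \<in> carrier_mat 4 4" and B: "B \<in> carrier_mat 4 4"
    and can: "qsic_conic_conj_lines (transpose_mat Q * A * Q) (transpose_mat Q * B * Q)"
  shows "qsic_conic_conj_lines A B"
proof -
  obtain C L X where h: "is_real_conic C" "is_line L" "L \<noteq> conj_vec ` L"
    "qsic (transpose_mat Q * A * Q) (transpose_mat Q * B * Q) = C \<union> L \<union> conj_vec ` L"
    "is_real_point X" "X \<in> C" "X \<in> L" "X \<in> conj_vec ` L"
    using can unfolding qsic_conic_conj_lines_def by blast
  have L: "L \<subseteq> carrier_vec 4" using line_carrier[OF h(2)] .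
  then have L': "conj_vec ` L \<subseteq> carrier_vec 4" by auto
  \<comment> \<open>The matrix \<open>Q\<close> is real, so conjugate lines are carried to conjugate
    lines.\<close>
  have conj: "S ` conj_vec ` L = conj_vec ` S ` L"
    using L conj_vec_cmat[OF Q] by (force simp: image_iff)
  have "S ` L \<noteq> conj_vec ` S ` L" using S_image_eq[OF L L'] h(3) conj by auto
  moreover have "qsic A B = S ` C \<union> S ` L \<union> conj_vec ` S ` L"
    by (simp add: qsic_image[OF A B] h(4) image_Un conj)
  moreover have "S X \<in> conj_vec ` S ` L" using h(8) unfolding conj[symmetric] by (rule imageI)
  ultimately show ?thesis
    unfolding qsic_conic_conj_lines_def
    using h S_is_real_conic S_is_line S_is_real_point by (meson imageI)
qed

end

section \<open>The intersection curve of the canonical pencil\<close>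

definition vec4 :: "'a list \<Rightarrow> 'a vec" where
  "vec4 xs = vec 4 ((!) xs)"

lemma vec4_carrier [simp]: "vec4 xs \<in> carrier_vec 4"
  by (simp add: vec4_def)

lemma vec4_dim [simp]: "dim_vec (vec4 xs) = 4"
  by (simp add: vec4_def)

lemma vec4_index [simp]: "i < 4 \<Longrightarrow> vec4 xs $ i = xs ! i"
  by (simp add: vec4_def)

lemma vec4_eqI:
  assumes "dim_vec v = 4" "dim_vec w = 4" "v $ 0 = w $ 0" "v $ 1 = w $ 1" "v $ 2 = w $ 2" "v $ 3 = w $ 3"
  shows "v = w"
proof (rule eq_vecI)
  fix i assume "i < dim_vec w"
  then show "v $ i = w $ i" using assms less_4_cases[of i] by auto
qed (use assms in simp)

lemma vec4_eq_iff [simp]: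
  "vec4 [a, b, c, d] = vec4 [a', b', c', d'] \<longleftrightarrow> a = a' \<and> b = b' \<and> c = c' \<and> d = d'"
proof
  assume eq: "vec4 [a, b, c, d] = vec4 [a', b', c', d']"
  show "a = a' \<and> b = b' \<and> c = c' \<and> d = d'"
    using arg_cong[OF eq, of "\<lambda>v. v $ 0"] arg_cong[OF eq, of "\<lambda>v. v $ 1"]
      arg_cong[OF eq, of "\<lambda>v. v $ 2"] arg_cong[OF eq, of "\<lambda>v. v $ 3"] by simp
qed simp

lemma vec4_zero: "0\<^sub>v 4 = vec4 [0, 0, 0, 0]"
  by (rule vec4_eqI) simp_all

lemma vec4_add [simp]:
  "vec4 [a, b, c, d] + vec4 [a', b', c', d'] = vec4 [a + a', b + b', c + c', d + d']"
  by (rule vec4_eqI) simp_all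

lemma vec4_smult [simp]: "k \<cdot>\<^sub>v vec4 [a, b, c, d] = vec4 [k * a, k * b, k * c, k * d]"
  by (rule vec4_eqI) simp_all

lemma vec4_cases:
  assumes "X \<in> carrier_vec 4"
  obtains a b c d where "X = vec4 [a, b, c, d]"
proof
  show "X = vec4 [X $ 0, X $ 1, X $ 2, X $ 3]" using assms by (intro vec4_eqI) simp_all
qed

lemma cvec_vec4: "cvec (vec4 [a, b, c, d]) = vec4 [of_real a, of_real b, of_real c, of_real d]"
  by (rule vec4_eqI) (simp_all add: cvec_def)

lemma conj_vec_vec4: "conj_vec (vec4 [a, b, c, d]) = vec4 [cnj a, cnj b, cnj c, cnj d]"
  by (rule vec4_eqI) (simp_all add: conj_vec_def)

lemma quadratic_form_vec4:
  assumes "M \<in> carrier_mat 4 4"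
  shows "vec4 [a, b, c, d] \<bullet> (cmat M *\<^sub>v vec4 [a, b, c, d]) =
    a * (cmat M $$ (0, 0) * a + cmat M $$ (0, 1) * b + cmat M $$ (0, 2) * c + cmat M $$ (0, 3) * d)
  + b * (cmat M $$ (1, 0) * a + cmat M $$ (1, 1) * b + cmat M $$ (1, 2) * c + cmat M $$ (1, 3) * d)
  + c * (cmat M $$ (2, 0) * a + cmat M $$ (2, 1) * b + cmat M $$ (2, 2) * c + cmat M $$ (2, 3) * d)
  + d * (cmat M $$ (3, 0) * a + cmat M $$ (3, 1) * b + cmat M $$ (3, 2) * c + cmat M $$ (3, 3) * d)"
proof -
  have "{0..<4} = {0, 1, 2, 3::nat}" by auto
  then show ?thesis using cmat_carrier[OF assms] by (simp add: scalar_prod_def algebra_simps)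
qed

text \<open>The second form equals \<open>l\<close> times the first plus
  \<open>2 * e * y * z\<close>. On the first quadric the second equation therefore reduces to
  \<open>y * z = 0\<close>.\<close>

lemma qsic_canonical:
  assumes e: "e \<in> {-1, 1}"
  shows "vec4 [x, y, z, w] \<in> qsic (canonA_31 e e2) (canonB_31 e e2 l) \<longleftrightarrow>
    (x, y, z, w) \<noteq> (0, 0, 0, 0) \<and> y * z = 0 \<and> of_int e * (2 * x * z + y\<^sup>2) + of_int e2 * w\<^sup>2 = 0"
    (is "_ \<longleftrightarrow> _ \<and> _ \<and> ?a = 0")
proof -
  have A: "vec4 [x, y, z, w] \<bullet> (cmat (canonA_31 e e2) *\<^sub>v vec4 [x, y, z, w]) = ?a"
    unfolding canonA_31_mat4
    by (subst quadratic_form_vec4) (simp_all add: cmat_def algebra_simps power2_eq_square)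
  have B: "vec4 [x, y, z, w] \<bullet> (cmat (canonB_31 e e2 l) *\<^sub>v vec4 [x, y, z, w])
      = of_real l * ?a + 2 * of_int e * (y * z)"
    unfolding canonB_31_mat4
    by (subst quadratic_form_vec4) (simp_all add: cmat_def algebra_simps power2_eq_square)
  have "(of_int e :: complex) \<noteq> 0" using e by auto
  then show ?thesis unfolding qsic_def mem_Collect_eq A B vec4_zero by auto
qed

definition canonical_conic :: "int \<Rightarrow> int \<Rightarrow> complex vec set" where
  "canonical_conic e e2 = {vec4 [x, 0, z, w] | x z w. (x, z, w) \<noteq> (0, 0, 0)
     \<and> of_int e * (2 * x * z) + of_int e2 * w\<^sup>2 = 0}"

lemma canonical_conic_is_real_conic:
  assumes e: "e \<in> {-1, 1}" "e2 \<in> {-1, 1}"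
  shows "is_real_conic (canonical_conic e e2)"
proof -
  let ?p = "vec4 [1, 0, 0, 0 :: real]" and ?q = "vec4 [0, 0, 1, 0 :: real]"
    and ?r = "vec4 [0, 0, 0, 1 :: real]"
  define M :: "real mat" where
    "M = mat 3 3 (\<lambda>(i, j). [[0, of_int e, 0], [of_int e, 0, 0], [0, 0, of_int e2]] ! i ! j)"
  have M: "M \<in> carrier_mat 3 3" by (simp add: M_def)
  have S3: "{0..<3} = {0, 1, 2::nat}" by auto
  have less3: "i < 3 \<Longrightarrow> i = 0 \<or> i = 1 \<or> i = 2" for i :: nat by auto
  have "transpose_mat M = M" by (rule eq_matI) (auto simp: M_def dest!: less3)
  \<comment> \<open>An involution has nonzero determinant, so the conic is nondegenerate.\<close>
  moreover have "M * M = 1\<^sub>m 3"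
    using e by (intro eq_matI) (auto simp: M_def scalar_prod_def S3 dest!: less3)
  then have "det M * det M = 1" using det_mult[OF M M] by simp
  then have "det M \<noteq> 0" by auto
  moreover have "lin_indep3 (cvec ?p) (cvec ?q) (cvec ?r)"
    by (auto simp: lin_indep3_def cvec_vec4 vec4_zero)
  moreover have "vec_of_list [x, z, w] \<bullet> (cmat M *\<^sub>v vec_of_list [x, z, w])
      = of_int e * (2 * x * z) + of_int e2 * w\<^sup>2" for x z w
    using cmat_carrier[OF M]
    by (simp add: scalar_prod_def S3 cmat_def M_def vec_of_list_index power2_eq_square algebra_simps
        del: vec_of_list_Cons)
  then have "canonical_conic e e2 = conic_set (cvec ?p) (cvec ?q) (cvec ?r) (cmat M)"
    by (auto simp: canonical_conic_def conic_set_def cvec_vec4)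
  ultimately show ?thesis unfolding is_real_conic_def using M vec4_carrier by blast
qed

lemma span_line_vec4:
  "span_line (vec4 [1, 0, 0, 0]) (vec4 [0, 1, 0, t]) = {vec4 [x, y, 0, t * y] | x y. (x, y) \<noteq> (0, 0)}"
  by (auto simp: span_line_def mult.commute)

lemma lin_indep2_vec4: "lin_indep2 (vec4 [1, 0, 0, 0]) (vec4 [0, 1, 0, t])"
  by (auto simp: lin_indep2_def vec4_zero)

text \<open>The plane \<open>z = 0\<close> meets the first quadric where
  \<open>w\<^sup>2 = - e * e2 * y\<^sup>2\<close>. With a square root \<open>t\<close> of
  \<open>- e * e2\<close> this factors into the lines \<open>w = t * y\<close> and
  \<open>w = - t * y\<close>. Keeping \<open>t\<close> as a parameter treats real and conjugate
  lines together.\<close>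

lemma qsic_canonical_decomposition:
  assumes e: "e \<in> {-1, 1}" "e2 \<in> {-1, 1}" and t: "t\<^sup>2 = - of_int (e * e2)"
  shows "qsic (canonA_31 e e2) (canonB_31 e e2 l) = canonical_conic e e2
    \<union> span_line (vec4 [1, 0, 0, 0]) (vec4 [0, 1, 0, t]) \<union> span_line (vec4 [1, 0, 0, 0]) (vec4 [0, 1, 0, - t])"
    (is "?qs = ?C \<union> ?L \<union> ?L'")
proof (intro equalityI subsetI)
  have ee: "of_int e * of_int e = (1 :: complex)" "of_int e2 * of_int e2 = (1 :: complex)" using e by auto
  fix X assume X: "X \<in> ?qs"
  then obtain x y z w where Xv: "X = vec4 [x, y, z, w]"
    using vec4_cases[of X] unfolding qsic_def by blast
  have nz: "(x, y, z, w) \<noteq> (0, 0, 0, 0)" and yz: "y * z = 0"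
    and q: "of_int e * (2 * x * z + y\<^sup>2) + of_int e2 * w\<^sup>2 = 0"
    using X qsic_canonical[OF e(1)] unfolding Xv by blast+
  show "X \<in> ?C \<union> ?L \<union> ?L'"
  \<comment> \<open>Every solution with \<open>y = 0\<close> lies on the conic, including those with
    \<open>z = 0\<close>; only \<open>y \<noteq> 0\<close> leads to the lines.\<close>
  proof (cases "y = 0")
    case True
    then show ?thesis using nz q by (auto simp: Xv canonical_conic_def)
  next
    case False
    then have z: "z = 0" using yz by simp
    have "of_int e2 * (of_int e * y\<^sup>2 + of_int e2 * w\<^sup>2) = 0" using q z by simp
    then have "(of_int e2 * of_int e2) * w\<^sup>2 = - of_int (e * e2) * y\<^sup>2"
      by (simp add: algebra_simps eq_neg_iff_add_eq_0)
    then have "w\<^sup>2 = (t * y)\<^sup>2" unfolding ee t[symmetric] by (simp add: power_mult_distrib)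
    then have "w = t * y \<or> w = - t * y" by (simp add: power2_eq_iff)
    then show ?thesis using False by (auto simp: Xv z span_line_vec4)
  qed
next
  have ee: "of_int e2 * of_int e2 = (1 :: complex)" using e by auto
  have "of_int e2 * t\<^sup>2 = - of_int e * (of_int e2 * of_int e2)" unfolding t by simp
  then have t': "of_int e2 * t\<^sup>2 = - of_int e" unfolding ee by simp
  have q: "of_int e * y\<^sup>2 + of_int e2 * (t * y)\<^sup>2 = 0" for y
  proof -
    have "of_int e * y\<^sup>2 + of_int e2 * (t * y)\<^sup>2 = (of_int e + of_int e2 * t\<^sup>2) * y\<^sup>2"
      by (simp add: algebra_simps power_mult_distrib)
    then show ?thesis by (simp add: t')
  qed
  fix X assume "X \<in> ?C \<union> ?L \<union> ?L'"
  then show "X \<in> ?qs"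
    using q by (auto simp: canonical_conic_def span_line_vec4 qsic_canonical[OF e(1)])
qed

lemma span_line_vec4_neq:
  assumes "t \<noteq> (0 :: complex)"
  shows "span_line (vec4 [1, 0, 0, 0]) (vec4 [0, 1, 0, t]) \<noteq> span_line (vec4 [1, 0, 0, 0]) (vec4 [0, 1, 0, - t])"
proof
  assume eq: "span_line (vec4 [1, 0, 0, 0]) (vec4 [0, 1, 0, t]) = span_line (vec4 [1, 0, 0, 0]) (vec4 [0, 1, 0, - t])"
  have "vec4 [0, 1, 0, t] \<in> span_line (vec4 [1, 0, 0, 0]) (vec4 [0, 1, 0, t])"
    by (auto simp: span_line_vec4)
  then show False unfolding eq using assms by (auto simp: span_line_vec4)
qed

lemma common_real_point:
  "is_real_point (vec4 [1, 0, 0, 0])" "vec4 [1, 0, 0, 0] \<in> canonical_conic e e2"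
  "vec4 [1, 0, 0, 0] \<in> span_line (vec4 [1, 0, 0, 0]) (vec4 [0, 1, 0, t])"
proof -
  show "is_real_point (vec4 [1, 0, 0, 0])"
    unfolding is_real_point_def
    by (intro exI[of _ "vec4 [1, 0, 0, 0]"]) (simp add: cvec_vec4)
qed (auto simp: canonical_conic_def span_line_vec4)

lemma is_real_line_vec4:
  "is_real_line (span_line (vec4 [1, 0, 0, 0]) (vec4 [0, 1, 0, of_real t]))"
  unfolding is_real_line_def
  by (intro exI[of _ "vec4 [1, 0, 0, 0]"] exI[of _ "vec4 [0, 1, 0, t]"])
    (simp add: cvec_vec4 lin_indep2_vec4)

lemma canonical_two_real_lines:
  assumes e: "e \<in> {-1, 1}" and "e2 = - e"
  shows "qsic_conic_two_real_lines (canonA_31 e e2) (canonB_31 e e2 l)"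
proof -
  \<comment> \<open>Opposite signs give \<open>- e * e2 = 1\<close>, so \<open>t = 1\<close> and
    both lines are real.\<close>
  have e2: "e2 \<in> {-1, 1}" and t: "(1 :: complex)\<^sup>2 = - of_int (e * e2)" using assms by auto
  show ?thesis
    unfolding qsic_conic_two_real_lines_def qsic_canonical_decomposition[OF e e2 t]
    using canonical_conic_is_real_conic[OF e e2] is_real_line_vec4[of 1] is_real_line_vec4[of "- 1"]
      span_line_vec4_neq[of 1] common_real_point
    by (intro exI conjI) (assumption | simp | rule refl)+
qed

lemma canonical_conj_lines:
  assumes e: "e \<in> {-1, 1}" and "e2 = e"
  shows "qsic_conic_conj_lines (canonA_31 e e2) (canonB_31 e e2 l)"
proof -
  \<comment> \<open>Equal signs give \<open>- e * e2 = -1\<close>, so \<open>t = \<i>\<close>;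
    conjugation then exchanges \<open>t\<close> and \<open>- t\<close>.\<close>
  have e2: "e2 \<in> {-1, 1}" and t: "\<i>\<^sup>2 = - of_int (e * e2)" using assms by auto
  let ?L = "\<lambda>t. span_line (vec4 [1, 0, 0, 0]) (vec4 [0, 1, 0, t :: complex])"
  have line: "is_line (?L \<i>)" unfolding is_line_def using lin_indep2_vec4 vec4_carrier by blast
  have conj: "conj_vec ` ?L \<i> = ?L (- \<i>)"
  proof (intro equalityI subsetI)
    fix X assume "X \<in> ?L (- \<i>)"
    then obtain x y where X: "X = vec4 [x, y, 0, - \<i> * y]" "(x, y) \<noteq> (0, 0)"
      by (auto simp: span_line_vec4)
    then have "X = conj_vec (vec4 [cnj x, cnj y, 0, \<i> * cnj y])" by (simp add: conj_vec_vec4)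
    moreover have "vec4 [cnj x, cnj y, 0, \<i> * cnj y] \<in> ?L \<i>"
      using X by (auto simp: span_line_vec4)
    ultimately show "X \<in> conj_vec ` ?L \<i>" by blast
  qed (auto simp: span_line_vec4 conj_vec_vec4)
  show ?thesis
    unfolding qsic_conic_conj_lines_def qsic_canonical_decomposition[OF e e2 t]
    using canonical_conic_is_real_conic[OF e e2] line conj[symmetric]
      span_line_vec4_neq[of \<i>] common_real_point
    by (intro exI conjI) (assumption | simp | rule refl)+
qed

section \<open>Classification of the pencils of type [(31)]\<close>

theorem theorem18:
  fixes A B :: "real mat" and l0 :: real
  assumes "A \<in> carrier_mat 4 4" and "B \<in> carrier_mat 4 4"
    and "transpose_mat A = A" and "transpose_mat B = B"
    and "\<exists>l. det (l \<cdot>\<^sub>m A - B) \<noteq> 0"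
    and "\<exists>c. c \<noteq> 0 \<and> (\<forall>l. det (l \<cdot>\<^sub>m A - B) = c * (l - l0) ^ 4)"
    and "segre_31 A B l0"
  shows "(idx_equiv (index_seq A B l0) (2, -1, 2) \<or> idx_equiv (index_seq A B l0) (1, 1, 3))
    \<and> (idx_equiv (index_seq A B l0) (2, -1, 2) \<longrightarrow> qsic_conic_two_real_lines A B)
    \<and> (idx_equiv (index_seq A B l0) (1, 1, 3) \<longrightarrow> qsic_conic_conj_lines A B)"
proof -
  obtain c where c: "c \<noteq> 0" "\<And>l. det (l \<cdot>\<^sub>m A - B) = c * (l - l0) ^ 4" using assms(6) by blast
  have detA: "det A \<noteq> 0" using det_leading_coefficient[OF assms(1,2) c(2)] c(1) by simp
  obtain Q e e2 where Q: "Q \<in> carrier_mat 4 4" "det Q \<noteq> 0" and e: "e \<in> {-1, 1}" "e2 \<in> {-1, 1}"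
    and QA: "transpose_mat Q * A * Q = canonA_31 e e2"
    and QB: "transpose_mat Q * B * Q = canonB_31 e e2 l0"
    using canonical_form_31[OF assms(1-4) detA assms(7)] by blast
  note idx = index_seq_canonical[OF assms(1,2) detA assms(3,4) Q(1,2) e(1,2) QA QB]
  obtain Qi where "Qi \<in> carrier_mat 4 4" "Q * Qi = 1\<^sub>m 4" "Qi * Q = 1\<^sub>m 4"
    using inverse_matrix[OF Q] .
  then interpret real_projectivity Q Qi using Q by unfold_locales
  \<comment> \<open>The relative sign of \<open>e\<close> and \<open>e2\<close> decides between the
    two types, for the index sequence as for the curve. The overall sign \<open>e\<close> is
    absorbed by \<open>idx_neg\<close>: it exchanges \<open>(2, 1, 2)\<close> with
    \<open>(2, -1, 2)\<close> and \<open>(3, -1, 1)\<close> with \<open>(1, 1, 3)\<close>. The two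
    types are inequivalent, so in each case one of the geometric implications is vacuous.\<close>
  show ?thesis
  proof (cases "e2 = - e")
    case True
    then have "qsic_conic_two_real_lines A B"
      using qsic_conic_two_real_lines_transfer[OF assms(1,2)] canonical_two_real_lines[OF e(1)]
      unfolding QA QB by blast
    then show ?thesis using True e by (auto simp: idx idx_equiv_def idx_neg_def)
  next
    case False
    then have "e2 = e" using e by auto
    then have "qsic_conic_conj_lines A B"
      using qsic_conic_conj_lines_transfer[OF assms(1,2)] canonical_conj_lines[OF e(1)]
      unfolding QA QB by blast
    then show ?thesis using False e by (auto simp: idx idx_equiv_def idx_neg_def)
  qed
qed

end
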